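(* Let $\mathcal{C}$ be a small $\mathbb{Z}$-linear category. Then the functors $$\mathcal{S}(-):\operatorname{Fun}(\mathcal{C}^{op},\operatorname{Ab})\to\operatorname{Mod}\text{-}\mathcal{A}(\mathcal{C}),\qquad (-)_{\mathcal{C}}:\operatorname{Mod}\text{-}\mathcal{A}(\mathcal{C})\to\operatorname{Fun}(\mathcal{C}^{op},\operatorname{Ab})$$ form an equivalence of categories (they are mutually quasi-inverse).
   Context: A $\mathbb{Z}$-linear category is a category whose hom-sets are abelian groups with bilinear composition. $\operatorname{Fun}(\mathcal{C}^{op},\operatorname{Ab})$ is the category of $\mathbb{Z}$-linear functors $\mathcal{C}^{op}\to\operatorname{Ab}$ and natural transformations. $\mathcal{A}(\mathcal{C})=\bigoplus_{a,b\in\operatorname{ob}\mathcal{C}}\operatorname{hom}_{\mathcal{C}}(a,b)$ is the (associative, possibly non-unital) ring in which, writing $f_{a,b}$ for the component of $f$ in $\operatorname{hom}_{\mathcal{C}}(b,a)$, $(fg)_{a,b}=\sum_{c}f_{a,c}\,g_{c,b}$. A right $\mathcal{A}(\mathcal{C})$-module $N$ is unital if $N\cdot\mathcal{A}(\mathcal{C})=N$; $\operatorname{Mod}\text{-}\mathcal{A}(\mathcal{C})$ is the category of unital right $\mathcal{A}(\mathcal{C})$-modules. $\mathcal{S}(M)=\bigoplus_{a\in\operatorname{ob}\mathcal{C}}M(a)$, where for $m\in M(b)$ and $f\in\operatorname{hom}_{\mathcal{C}}(a,b')$ one has $m\cdot f=M(f)(m)\in M(a)$ if $b=b'$ and $m\cdot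 f=0$ otherwise. $N_{\mathcal{C}}$ is the functor $a\mapsto N\cdot\operatorname{id}_a$, with $f:a\to b$ acting by right multiplication $N\cdot\operatorname{id}_b\to N\cdot\operatorname{id}_a$, $x\mapsto x\cdot f$. Both constructions act on morphisms in the evident way. *)

theory Defs
  imports "HOL-Algebra.Free_Abelian_Groups" "HOL-Algebra.Ring"
begin

section \<open>Categories, functors, natural transformations\<close>

text \<open>Hom-sets need not be disjoint, so composition carries its objects:
  \<open>Comp C a b c g f\<close> is the composite of \<open>f : a \<rightarrow> b\<close> and \<open>g : b \<rightarrow> c\<close>.\<close>

record ('o, 'm) category =
  Ob :: "'o set"
  Hom :: "'o \<Rightarrow> 'o \<Rightarrow> 'm set"
  Ident :: "'o \<Rightarrow> 'm"
  Comp :: "'o \<Rightarrow> 'o \<Rightarrow> 'o \<Rightarrow> 'm \<Rightarrow> 'm \<Rightarrow> 'm"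

locale category =
  fixes C :: "('o, 'm, 'x) category_scheme"
  assumes Ident_closed: "a \<in> Ob C \<Longrightarrow> Ident C a \<in> Hom C a a"
    and Comp_closed: "\<lbrakk>a \<in> Ob C; b \<in> Ob C; c \<in> Ob C; f \<in> Hom C a b; g \<in> Hom C b c\<rbrakk>
      \<Longrightarrow> Comp C a b c g f \<in> Hom C a c"
    and Comp_Ident: "\<lbrakk>a \<in> Ob C; b \<in> Ob C; f \<in> Hom C a b\<rbrakk> \<Longrightarrow> Comp C a a b f (Ident C a) = f"
    and Ident_Comp: "\<lbrakk>a \<in> Ob C; b \<in> Ob C; f \<in> Hom C a b\<rbrakk> \<Longrightarrow> Comp C a b b (Ident C b) f = f"
    and Comp_assoc: "\<lbrakk>a \<in> Ob C; b \<in> Ob C; c \<in> Ob C; d \<in> Ob C;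
        f \<in> Hom C a b; g \<in> Hom C b c; h \<in> Hom C c d\<rbrakk>
      \<Longrightarrow> Comp C a c d h (Comp C a b c g f) = Comp C a b d (Comp C b c d h g) f"

definition isomorphism :: "('o, 'm, 'x) category_scheme \<Rightarrow> 'o \<Rightarrow> 'o \<Rightarrow> 'm \<Rightarrow> bool" where
  "isomorphism C a b f \<longleftrightarrow> f \<in> Hom C a b \<and>
     (\<exists>g \<in> Hom C b a. Comp C a b a g f = Ident C a \<and> Comp C b a b f g = Ident C b)"

text \<open>\<open>FMor F a b\<close> is the action on \<open>Hom a b\<close>. Values of \<open>FOb\<close> and \<open>FMor\<close> outside the objects
  and morphisms of the source are irrelevant and not normalised.\<close>

record ('o1, 'm1, 'o2, 'm2) cat_functor =
  FOb :: "'o1 \<Rightarrow> 'o2"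
  FMor :: "'o1 \<Rightarrow> 'o1 \<Rightarrow> 'm1 \<Rightarrow> 'm2"

locale cat_functor = source: category A + target: category B
  for A :: "('o1, 'm1, 'x) category_scheme" and B :: "('o2, 'm2, 'y) category_scheme" +
  fixes F :: "('o1, 'm1, 'o2, 'm2) cat_functor"
  assumes FOb_closed: "a \<in> Ob A \<Longrightarrow> FOb F a \<in> Ob B"
    and FMor_closed: "\<lbrakk>a \<in> Ob A; b \<in> Ob A; f \<in> Hom A a b\<rbrakk>
      \<Longrightarrow> FMor F a b f \<in> Hom B (FOb F a) (FOb F b)"
    and FMor_Ident: "a \<in> Ob A \<Longrightarrow> FMor F a a (Ident A a) = Ident B (FOb F a)"
    and FMor_Comp: "\<lbrakk>a \<in> Ob A; b \<in> Ob A; c \<in> Ob A; f \<in> Hom A a b; g \<in> Hom A b c\<rbrakk>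
      \<Longrightarrow> FMor F a c (Comp A a b c g f)
        = Comp B (FOb F a) (FOb F b) (FOb F c) (FMor F b c g) (FMor F a b f)"

definition id_functor :: "('o, 'm, 'o, 'm) cat_functor" where
  "id_functor = \<lparr>FOb = (\<lambda>a. a), FMor = (\<lambda>a b f. f)\<rparr>"

definition comp_functor ::
    "('o2, 'm2, 'o3, 'm3) cat_functor \<Rightarrow> ('o1, 'm1, 'o2, 'm2) cat_functor
      \<Rightarrow> ('o1, 'm1, 'o3, 'm3) cat_functor" where
  "comp_functor G F =
     \<lparr>FOb = (\<lambda>a. FOb G (FOb F a)),
      FMor = (\<lambda>a b f. FMor G (FOb F a) (FOb F b) (FMor F a b f))\<rparr>"

text \<open>Families of components are extensional, so that equality of natural transformations is
  equality of components.\<close>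

definition nat_trans ::
    "('o1, 'm1, 'x) category_scheme \<Rightarrow> ('o2, 'm2, 'y) category_scheme
      \<Rightarrow> ('o1, 'm1, 'o2, 'm2) cat_functor \<Rightarrow> ('o1, 'm1, 'o2, 'm2) cat_functor
      \<Rightarrow> ('o1 \<Rightarrow> 'm2) set" where
  "nat_trans A B F G =
     {\<tau> \<in> (\<Pi>\<^sub>E a \<in> Ob A. Hom B (FOb F a) (FOb G a)).
        \<forall>a \<in> Ob A. \<forall>b \<in> Ob A. \<forall>f \<in> Hom A a b.
          Comp B (FOb F a) (FOb F b) (FOb G b) (\<tau> b) (FMor F a b f)
          = Comp B (FOb F a) (FOb G a) (FOb G b) (FMor G a b f) (\<tau> a)}"

definition naturally_isomorphic ::
    "('o1, 'm1, 'x) category_scheme \<Rightarrow> ('o2, 'm2, 'y) category_scheme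
      \<Rightarrow> ('o1, 'm1, 'o2, 'm2) cat_functor \<Rightarrow> ('o1, 'm1, 'o2, 'm2) cat_functor \<Rightarrow> bool" where
  "naturally_isomorphic A B F G \<longleftrightarrow>
     (\<exists>\<tau> \<in> nat_trans A B F G. \<forall>a \<in> Ob A. isomorphism B (FOb F a) (FOb G a) (\<tau> a))"

definition mutually_quasi_inverse ::
    "('o1, 'm1, 'x) category_scheme \<Rightarrow> ('o2, 'm2, 'y) category_scheme
      \<Rightarrow> ('o1, 'm1, 'o2, 'm2) cat_functor \<Rightarrow> ('o2, 'm2, 'o1, 'm1) cat_functor \<Rightarrow> bool" where
  "mutually_quasi_inverse A B F G \<longleftrightarrow>
     cat_functor A B F \<and> cat_functor B A G \<and>
     naturally_isomorphic A A id_functor (comp_functor G F) \<and>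
     naturally_isomorphic B B (comp_functor F G) id_functor"


section \<open>\<open>\<int>\<close>-linear categories\<close>

text \<open>Abelian groups are HOL-Algebra's \<^const>\<open>comm_group\<close>s, hence written multiplicatively.\<close>

record ('o, 'm) linear_category = "('o, 'm) category" +
  hadd :: "'o \<Rightarrow> 'o \<Rightarrow> 'm \<Rightarrow> 'm \<Rightarrow> 'm"
  hzero :: "'o \<Rightarrow> 'o \<Rightarrow> 'm"

definition hom_group :: "('o, 'm, 'x) linear_category_scheme \<Rightarrow> 'o \<Rightarrow> 'o \<Rightarrow> 'm monoid" where
  "hom_group C a b = \<lparr>carrier = Hom C a b, monoid.mult = hadd C a b, one = hzero C a b\<rparr>"

locale linear_category = category C
  for C :: "('o, 'm, 'x) linear_category_scheme" +
  assumes hom_comm_group: "\<lbrakk>a \<in> Ob C; b \<in> Ob C\<rbrakk> \<Longrightarrow> comm_group (hom_group C a b)"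
    and Comp_hadd_left: "\<lbrakk>a \<in> Ob C; b \<in> Ob C; c \<in> Ob C;
        f \<in> Hom C a b; g \<in> Hom C b c; g' \<in> Hom C b c\<rbrakk>
      \<Longrightarrow> Comp C a b c (hadd C b c g g') f = hadd C a c (Comp C a b c g f) (Comp C a b c g' f)"
    and Comp_hadd_right: "\<lbrakk>a \<in> Ob C; b \<in> Ob C; c \<in> Ob C;
        f \<in> Hom C a b; f' \<in> Hom C a b; g \<in> Hom C b c\<rbrakk>
      \<Longrightarrow> Comp C a b c g (hadd C a b f f') = hadd C a c (Comp C a b c g f) (Comp C a b c g f')"

definition opposite :: "('o, 'm) linear_category \<Rightarrow> ('o, 'm) linear_category" where
  "opposite C =
     \<lparr>Ob = Ob C, Hom = (\<lambda>a b. Hom C b a), Ident = Ident C,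
      Comp = (\<lambda>a b c g f. Comp C c b a f g),
      hadd = (\<lambda>a b. hadd C b a), hzero = (\<lambda>a b. hzero C b a)\<rparr>"

text \<open>The category of abelian groups with carrier in the type \<open>'u\<close>, which plays the role of
  the universe. Morphisms are extensional.\<close>

definition Ab :: "('u monoid, 'u \<Rightarrow> 'u) linear_category" where
  "Ab =
     \<lparr>Ob = {G. comm_group G},
      Hom = (\<lambda>G H. hom G H \<inter> extensional (carrier G)),
      Ident = (\<lambda>G. \<lambda>x \<in> carrier G. x),
      Comp = (\<lambda>G H K g f. compose (carrier G) g f),
      hadd = (\<lambda>G H f g. \<lambda>x \<in> carrier G. f x \<otimes>\<^bsub>H\<^esub> g x),
      hzero = (\<lambda>G H. \<lambda>x \<in> carrier G. \<one>\<^bsub>H\<^esub>)\<rparr>"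

locale linear_functor = cat_functor A B F + source: linear_category A + target: linear_category B
  for A :: "('o1, 'm1, 'x) linear_category_scheme"
    and B :: "('o2, 'm2, 'y) linear_category_scheme"
    and F :: "('o1, 'm1, 'o2, 'm2) cat_functor" +
  assumes FMor_hom: "\<lbrakk>a \<in> Ob A; b \<in> Ob A\<rbrakk>
    \<Longrightarrow> FMor F a b \<in> hom (hom_group A a b) (hom_group B (FOb F a) (FOb F b))"

definition functor_category ::
    "('o1, 'm1) linear_category \<Rightarrow> ('o2, 'm2) linear_category
      \<Rightarrow> (('o1, 'm1, 'o2, 'm2) cat_functor, 'o1 \<Rightarrow> 'm2) category" where
  "functor_category A B =
     \<lparr>Ob = {F. linear_functor A B F},
      Hom = nat_trans A B,
      Ident = (\<lambda>F. \<lambda>a \<in> Ob A. Ident B (FOb F a)),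
      Comp = (\<lambda>F G H \<tau> \<sigma>. \<lambda>a \<in> Ob A. Comp B (FOb F a) (FOb G a) (FOb H a) (\<tau> a) (\<sigma> a))\<rparr>"


section \<open>Unital right modules over a non-unital ring\<close>

text \<open>The field \<^const>\<open>one\<close> of the ring record is ignored: rings need not have a unit.\<close>

locale nonunital_ring = abelian_group R for R (structure) +
  assumes m_closed: "\<lbrakk>x \<in> carrier R; y \<in> carrier R\<rbrakk> \<Longrightarrow> x \<otimes> y \<in> carrier R"
    and m_assoc: "\<lbrakk>x \<in> carrier R; y \<in> carrier R; z \<in> carrier R\<rbrakk>
      \<Longrightarrow> (x \<otimes> y) \<otimes> z = x \<otimes> (y \<otimes> z)"
    and l_distr: "\<lbrakk>x \<in> carrier R; y \<in> carrier R; z \<in> carrier R\<rbrakk>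
      \<Longrightarrow> (x \<oplus> y) \<otimes> z = x \<otimes> z \<oplus> y \<otimes> z"
    and r_distr: "\<lbrakk>x \<in> carrier R; y \<in> carrier R; z \<in> carrier R\<rbrakk>
      \<Longrightarrow> z \<otimes> (x \<oplus> y) = z \<otimes> x \<oplus> z \<otimes> y"

record ('u, 'r) right_module = "'u monoid" +
  act :: "'u \<Rightarrow> 'r \<Rightarrow> 'u"

locale right_module = ring: nonunital_ring R + comm_group N
  for R :: "('r, 'x) ring_scheme" and N :: "('u, 'r, 'y) right_module_scheme" +
  assumes act_closed: "\<lbrakk>x \<in> carrier N; r \<in> carrier R\<rbrakk> \<Longrightarrow> act N x r \<in> carrier N"
    and act_add_left: "\<lbrakk>x \<in> carrier N; y \<in> carrier N; r \<in> carrier R\<rbrakk>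
      \<Longrightarrow> act N (x \<otimes>\<^bsub>N\<^esub> y) r = act N x r \<otimes>\<^bsub>N\<^esub> act N y r"
    and act_add_right: "\<lbrakk>x \<in> carrier N; r \<in> carrier R; s \<in> carrier R\<rbrakk>
      \<Longrightarrow> act N x (r \<oplus>\<^bsub>R\<^esub> s) = act N x r \<otimes>\<^bsub>N\<^esub> act N x s"
    and act_mult: "\<lbrakk>x \<in> carrier N; r \<in> carrier R; s \<in> carrier R\<rbrakk>
      \<Longrightarrow> act N x (r \<otimes>\<^bsub>R\<^esub> s) = act N (act N x r) s"

text \<open>\<open>N \<cdot> R\<close> is the additive subgroup generated by the products.\<close>

definition unital_module ::
    "('r, 'x) ring_scheme \<Rightarrow> ('u, 'r, 'y) right_module_scheme \<Rightarrow> bool" where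
  "unital_module R N \<longleftrightarrow>
     generate N {act N x r |x r. x \<in> carrier N \<and> r \<in> carrier R} = carrier N"

definition unital_modules :: "'r ring \<Rightarrow> (('u, 'r) right_module, 'u \<Rightarrow> 'u) category" where
  "unital_modules R =
     \<lparr>Ob = {N. right_module R N \<and> unital_module R N},
      Hom = (\<lambda>N P. {\<phi> \<in> hom N P \<inter> extensional (carrier N).
               \<forall>x \<in> carrier N. \<forall>r \<in> carrier R. \<phi> (act N x r) = act P (\<phi> x) r}),
      Ident = (\<lambda>N. \<lambda>x \<in> carrier N. x),
      Comp = (\<lambda>N P Q \<psi> \<phi>. compose (carrier N) \<psi> \<phi>)\<rparr>"


section \<open>The ring \<open>\<A>(\<C>)\<close>\<close>

text \<open>The component of \<open>f\<close> at \<open>(a, b)\<close> lies in \<open>Hom C b a\<close>. All but finitely many terms of the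
  sums below are zero; \<^const>\<open>gfinprod\<close> sums over the support.\<close>

definition category_ring :: "('o, 'm) linear_category \<Rightarrow> ('o \<times> 'o \<Rightarrow> 'm) ring" where
  "category_ring C =
     (let S = sum_group (Ob C \<times> Ob C) (\<lambda>(a, b). hom_group C b a) in
      \<lparr>carrier = carrier S,
       monoid.mult = (\<lambda>f g. \<lambda>(a, b) \<in> Ob C \<times> Ob C.
         gfinprod (hom_group C b a) (\<lambda>c. Comp C b c a (f (a, c)) (g (c, b))) (Ob C)),
       one = undefined,
       ring.zero = \<one>\<^bsub>S\<^esub>,
       ring.add = monoid.mult S\<rparr>)"

text \<open>The element of the ring given by a single morphism \<open>f : a \<rightarrow> b\<close>.\<close>

definition single :: "('o, 'm) linear_category \<Rightarrow> 'o \<Rightarrow> 'o \<Rightarrow> 'm \<Rightarrow> 'o \<times> 'o \<Rightarrow> 'm" where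
  "single C a b f = (\<lambda>(p, q) \<in> Ob C \<times> Ob C. if p = b \<and> q = a then f else hzero C q p)"


section \<open>The functor \<open>\<S>\<close>\<close>

text \<open>The direct sum of the \<open>M(a)\<close>. The action is the biadditive extension of
  \<open>m \<cdot> f = M(f)(m)\<close> for \<open>m \<in> M(b)\<close>, \<open>f : a \<rightarrow> b\<close> (and zero if the objects do not match).\<close>

definition direct_sum_module ::
    "('o, 'm) linear_category \<Rightarrow> ('o, 'm, 'u monoid, 'u \<Rightarrow> 'u) cat_functor
      \<Rightarrow> ('o \<Rightarrow> 'u, 'o \<times> 'o \<Rightarrow> 'm) right_module" where
  "direct_sum_module C M =
     (let S = sum_group (Ob C) (FOb M) in
      \<lparr>carrier = carrier S, monoid.mult = monoid.mult S, one = \<one>\<^bsub>S\<^esub>,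
       act = (\<lambda>m f. \<lambda>a \<in> Ob C.
         gfinprod (FOb M a) (\<lambda>b. FMor M b a (f (b, a)) (m b)) (Ob C))\<rparr>)"

text \<open>The elements of the direct sum are functions \<open>'o \<Rightarrow> 'u\<close>. To obtain a module with carrier
  in \<open>'u\<close>, its structure is transported along some injection of its carrier into \<open>'u\<close>,
  which exists if \<open>'u\<close> is infinite and at least as large as the set of objects.\<close>

definition to_universe :: "'v set \<Rightarrow> 'v \<Rightarrow> 'u" where
  "to_universe A = (SOME e. inj_on e A)"

definition from_universe :: "'v set \<Rightarrow> 'u \<Rightarrow> 'v" where
  "from_universe A = inv_into A (to_universe A)"

definition transport_module :: "('v, 'r) right_module \<Rightarrow> ('u, 'r) right_module" where
  "transport_module N =
     (let e = to_universe (carrier N); d = from_universe (carrier N) in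
      \<lparr>carrier = e ` carrier N,
       monoid.mult = (\<lambda>x y. e (d x \<otimes>\<^bsub>N\<^esub> d y)), one = e \<one>\<^bsub>N\<^esub>,
       act = (\<lambda>x r. e (act N (d x) r))\<rparr>)"

definition transport_map ::
    "('v, 'r) right_module \<Rightarrow> ('v, 'r) right_module \<Rightarrow> ('v \<Rightarrow> 'v) \<Rightarrow> 'u \<Rightarrow> 'u" where
  "transport_map N P \<phi> =
     (\<lambda>x \<in> to_universe (carrier N) ` carrier N. to_universe (carrier P) (\<phi> (from_universe (carrier N) x)))"

definition sum_functor ::
    "('o, 'm) linear_category
      \<Rightarrow> (('o, 'm, 'u monoid, 'u \<Rightarrow> 'u) cat_functor, 'o \<Rightarrow> 'u \<Rightarrow> 'u,
          ('u, 'o \<times> 'o \<Rightarrow> 'm) right_module, 'u \<Rightarrow> 'u) cat_functor" where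
  "sum_functor C =
     \<lparr>FOb = (\<lambda>M. transport_module (direct_sum_module C M)),
      FMor = (\<lambda>M M' \<tau>. transport_map (direct_sum_module C M) (direct_sum_module C M')
                (\<lambda>m. \<lambda>a \<in> Ob C. \<tau> a (m a)))\<rparr>"


section \<open>The functor \<open>(-)\<^sub>\<C>\<close>\<close>

definition component ::
    "('o, 'm) linear_category \<Rightarrow> ('u, 'o \<times> 'o \<Rightarrow> 'm) right_module \<Rightarrow> 'o \<Rightarrow> 'u monoid" where
  "component C N a =
     \<lparr>carrier = (\<lambda>x. act N x (single C a a (Ident C a))) ` carrier N,
      monoid.mult = monoid.mult N, one = \<one>\<^bsub>N\<^esub>\<rparr>"

text \<open>In \<open>module_functor C N\<close>, which is a functor on the opposite category, the argument
  \<open>f \<in> Hom (opposite C) b a\<close> is a morphism \<open>a \<rightarrow> b\<close> of \<open>C\<close>.\<close>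

definition module_functor ::
    "('o, 'm) linear_category \<Rightarrow> ('u, 'o \<times> 'o \<Rightarrow> 'm) right_module
      \<Rightarrow> ('o, 'm, 'u monoid, 'u \<Rightarrow> 'u) cat_functor" where
  "module_functor C N =
     \<lparr>FOb = component C N,
      FMor = (\<lambda>b a f. \<lambda>x \<in> carrier (component C N b). act N x (single C a b f))\<rparr>"

definition component_functor ::
    "('o, 'm) linear_category
      \<Rightarrow> (('u, 'o \<times> 'o \<Rightarrow> 'm) right_module, 'u \<Rightarrow> 'u,
          ('o, 'm, 'u monoid, 'u \<Rightarrow> 'u) cat_functor, 'o \<Rightarrow> 'u \<Rightarrow> 'u) cat_functor" where
  "component_functor C =
     \<lparr>FOb = module_functor C,
      FMor = (\<lambda>N P \<phi>. \<lambda>a \<in> Ob C. restrict \<phi> (carrier (component C N a)))\<rparr>"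

end

theory Submission
  imports Defs
begin

text \<open>Write \<open>A\<close> for the ring of the linear category \<open>C\<close>. Its elements are finite sums of single
  morphisms, the product of \<open>g : b' \<rightarrow> c\<close> and \<open>f : a \<rightarrow> b\<close> is \<open>g \<circ> f\<close> if \<open>b = b'\<close> and zero otherwise, and
  the identities \<open>id\<^sub>a\<close> are orthogonal idempotents. The unit of the equivalence sends \<open>x \<in> M(a)\<close> to
  the family in \<open>\<Oplus>\<^sub>b M(b)\<close> whose only entry is \<open>x\<close>, at \<open>a\<close>. As multiplication by \<open>id\<^sub>a\<close> is the
  projection to the summand at \<open>a\<close>, this is a bijection of \<open>M(a)\<close> onto the part of the direct sum that
  \<open>id\<^sub>a\<close> cuts out (\<open>unit_bij\<close>). The counit sums up a family in \<open>\<Oplus>\<^sub>a N \<cdot> id\<^sub>a\<close> inside \<open>N\<close>. It is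
  injective because multiplying the sum by \<open>id\<^sub>a\<close> returns the entry at \<open>a\<close>, and surjective because \<open>N\<close>
  is generated by products \<open>x \<cdot> f\<close> with a single morphism \<open>f : a \<rightarrow> b\<close>, and \<open>x \<cdot> f = x \<cdot> f \<cdot> id\<^sub>a\<close>
  (\<open>counit_bij\<close>).

  The work lies in the ring and module axioms, which involve sums over all objects. Two
  observations keep these sums out of most proofs. First, all maps in question are additive in each
  argument, and a homomorphism out of a direct sum is determined on single summands
  (\<open>sum_group_hom_eq\<close>). So once additivity is established, an identity needs to be checked only for
  single morphisms and single entries, where the action is \<open>m \<cdot> f = M(f)(m)\<close> (\<open>act_single\<close>). Second,
  the product in \<open>A\<close> is computed row by row, and on the row at \<open>p\<close> it is the action of \<open>A\<close> on the
  direct sum of the representable presheaf at \<open>p\<close> (\<open>ring_mult_component\<close>). So the properties of the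
  action for arbitrary presheaves imply the ring axioms.

  The module attached to a presheaf is moved along an injection into the universe, which exists by a
  cardinality count (\<open>inj_to_universe\<close>). This replaces the module by an isomorphic one.\<close>

section \<open>Direct sums of abelian groups\<close>

definition sum_inj :: "'i set \<Rightarrow> ('i \<Rightarrow> ('u, 'x) monoid_scheme) \<Rightarrow> 'i \<Rightarrow> 'u \<Rightarrow> 'i \<Rightarrow> 'u" where
  "sum_inj I G i x = (\<lambda>j \<in> I. if j = i then x else \<one>\<^bsub>G j\<^esub>)"

lemma sum_group_eqI:
  assumes "\<And>i. i \<in> I \<Longrightarrow> group (G i)"
    and "x \<in> carrier (sum_group I G)" "y \<in> carrier (sum_group I G)"
    and "\<And>i. i \<in> I \<Longrightarrow> x i = y i"
  shows "x = y"
proof (rule extensionalityI)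
  show "x \<in> extensional I" "y \<in> extensional I"
    using assms(2,3) by (auto simp: carrier_sum_group assms(1) PiE_def)
qed (rule assms(4))

lemma sum_inj_closed:
  assumes "\<And>i. i \<in> I \<Longrightarrow> group (G i)" "i \<in> I" "x \<in> carrier (G i)"
  shows "sum_inj I G i x \<in> carrier (sum_group I G)"
proof -
  have "{j \<in> I. sum_inj I G i x j \<noteq> \<one>\<^bsub>G j\<^esub>} \<subseteq> {i}"
    by (auto simp: sum_inj_def)
  then have "finite {j \<in> I. sum_inj I G i x j \<noteq> \<one>\<^bsub>G j\<^esub>}"
    by (rule finite_subset) simp
  then show ?thesis
    using assms by (auto simp: carrier_sum_group sum_inj_def group.is_monoid)
qed

lemma sum_inj_mult:
  assumes "\<And>i. i \<in> I \<Longrightarrow> group (G i)"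
  shows "sum_inj I G i (x \<otimes>\<^bsub>G i\<^esub> y) = sum_inj I G i x \<otimes>\<^bsub>sum_group I G\<^esub> sum_inj I G i y"
  using assms by (auto simp: sum_inj_def fun_eq_iff group.is_monoid)

lemma comm_group_sum_group:
  assumes "\<And>i. i \<in> I \<Longrightarrow> comm_group (G i)"
  shows "comm_group (sum_group I G)"
proof -
  have G: "group (G i)" if "i \<in> I" for i
    using assms[OF that] by (simp add: comm_group_def)
  show ?thesis
  proof (rule group.group_comm_groupI)
    show "x \<otimes>\<^bsub>sum_group I G\<^esub> y = y \<otimes>\<^bsub>sum_group I G\<^esub> x"
      if "x \<in> carrier (sum_group I G)" "y \<in> carrier (sum_group I G)" for x y
      using that assms
      by (auto simp: carrier_sum_group G PiE_iff fun_eq_iff comm_groupE(4))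
  qed (simp add: G)
qed

text \<open>By induction on the size of the support: split off one nonzero entry.\<close>

lemma sum_group_induct [consumes 1, case_names group one sum_inj mult]:
  assumes x: "x \<in> carrier (sum_group I G)" and G: "\<And>i. i \<in> I \<Longrightarrow> group (G i)"
    and one: "P \<one>\<^bsub>sum_group I G\<^esub>"
    and sum_inj: "\<And>i x. \<lbrakk>i \<in> I; x \<in> carrier (G i)\<rbrakk> \<Longrightarrow> P (sum_inj I G i x)"
    and mult: "\<And>x y. \<lbrakk>x \<in> carrier (sum_group I G); y \<in> carrier (sum_group I G); P x; P y\<rbrakk>
      \<Longrightarrow> P (x \<otimes>\<^bsub>sum_group I G\<^esub> y)"
  shows "P x"
proof -
  let ?S = "sum_group I G"
  have S: "group ?S"
    by (simp add: G)
  have "finite {i \<in> I. x i \<noteq> \<one>\<^bsub>G i\<^esub>}"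
    using x by (simp add: carrier_sum_group G)
  then show ?thesis
    using x
  proof (induction "{i \<in> I. x i \<noteq> \<one>\<^bsub>G i\<^esub>}" arbitrary: x rule: finite_induct)
    case empty
    then have "x = \<one>\<^bsub>?S\<^esub>"
      by (intro sum_group_eqI[of I G]) (auto simp: G group.is_monoid[OF S] simp del: one_sum_group, auto)
    then show ?case
      using one by (simp del: one_sum_group)
  next
    case (insert i A)
    have xG: "x j \<in> carrier (G j)" if "j \<in> I" for j
      using insert.prems that by (auto simp: carrier_sum_group G)
    have i: "i \<in> I"
      using insert.hyps by auto
    define y where "y = (\<lambda>j \<in> I. if j = i then \<one>\<^bsub>G j\<^esub> else x j)"
    have supp: "{j \<in> I. y j \<noteq> \<one>\<^bsub>G j\<^esub>} = A"
      using insert.hyps by (auto simp: y_def)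
    have y: "y \<in> carrier ?S"
      using supp insert.hyps(1) xG by (auto simp: carrier_sum_group G y_def group.is_monoid)
    have d: "sum_inj I G i (x i) \<in> carrier ?S"
      by (rule sum_inj_closed) (use G i xG in auto)
    have x_eq: "x = sum_inj I G i (x i) \<otimes>\<^bsub>?S\<^esub> y"
    proof (rule sum_group_eqI[OF G insert.prems])
      show "sum_inj I G i (x i) \<otimes>\<^bsub>?S\<^esub> y \<in> carrier ?S"
        using S d y by (simp add: group.is_monoid monoid.m_closed del: mult_sum_group)
      show "x j = (sum_inj I G i (x i) \<otimes>\<^bsub>?S\<^esub> y) j" if "j \<in> I" for j
        using that G[OF that] xG[OF that] by (auto simp: y_def sum_inj_def group.is_monoid)
    qed
    have "P y"
      by (rule insert.hyps(3)) (use supp y in auto)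
    then show ?case
      by (subst x_eq) (intro mult d y sum_inj i xG)
  qed
qed

text \<open>The summands generate the direct sum. Every identity below that is additive in some argument
  is checked on single summands by this lemma, which avoids the manipulation of iterated sums.\<close>

lemma sum_group_hom_eq:
  assumes G: "\<And>i. i \<in> I \<Longrightarrow> group (G i)" and H: "group H"
    and h: "h \<in> hom (sum_group I G) H" and k: "k \<in> hom (sum_group I G) H"
    and eq: "\<And>i x. \<lbrakk>i \<in> I; x \<in> carrier (G i)\<rbrakk> \<Longrightarrow> h (sum_inj I G i x) = k (sum_inj I G i x)"
    and x: "x \<in> carrier (sum_group I G)"
  shows "h x = k x"
  using x
proof (induction rule: sum_group_induct)
  case one
  have "group (sum_group I G)"
    by (simp add: G)
  then show ?case
    using hom_one[OF h _ H] hom_one[OF k _ H] by metis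
next
  case (mult x y)
  then show ?case
    using hom_mult[OF h] hom_mult[OF k] by metis
qed (rule G eq; assumption)+

lemma sum_group_homI:
  assumes "\<And>i. i \<in> I \<Longrightarrow> group (G i)" "group H"
    and closed: "\<And>x. x \<in> carrier H \<Longrightarrow> h x \<in> carrier (sum_group I G)"
    and hom: "\<And>i. i \<in> I \<Longrightarrow> (\<lambda>x. h x i) \<in> hom H (G i)"
  shows "h \<in> hom H (sum_group I G)"
proof (rule homI)
  fix x y
  assume x: "x \<in> carrier H" and y: "y \<in> carrier H"
  show "h (x \<otimes>\<^bsub>H\<^esub> y) = h x \<otimes>\<^bsub>sum_group I G\<^esub> h y"
  proof (rule sum_group_eqI[of I G])
    show "h (x \<otimes>\<^bsub>H\<^esub> y) \<in> carrier (sum_group I G)"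
      using x y assms(2) by (intro closed) (simp add: group.is_monoid monoid.m_closed)
    show "h x \<otimes>\<^bsub>sum_group I G\<^esub> h y \<in> carrier (sum_group I G)"
      using closed[OF x] closed[OF y] assms(1)
      by (simp add: group.is_monoid monoid.m_closed del: mult_sum_group)
    show "h (x \<otimes>\<^bsub>H\<^esub> y) i = (h x \<otimes>\<^bsub>sum_group I G\<^esub> h y) i" if "i \<in> I" for i
      using hom_mult[OF hom[OF that] x y] that by simp
  qed (rule assms(1))
qed (rule closed)

lemma sum_group_proj_hom:
  assumes "\<And>i. i \<in> I \<Longrightarrow> group (G i)" "i \<in> I"
  shows "(\<lambda>x. x i) \<in> hom (sum_group I G) (G i)"
  using assms by (auto intro!: homI simp: carrier_sum_group)

lemma (in comm_monoid) gfinprod_singleton: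
  assumes "i \<in> A" "f i \<in> carrier G" "\<And>j. j \<in> A \<Longrightarrow> j \<noteq> i \<Longrightarrow> f j = \<one>"
  shows "gfinprod G f A = f i"
proof -
  have "f j \<in> carrier G" if "j \<in> A" for j
    using assms that by (cases "j = i") auto
  then have "gfinprod G f A = gfinprod G f {i}"
    using assms by (intro gfinprod_mono_neutral_cong_right) auto
  also have "\<dots> = f i"
    using assms by simp
  finally show ?thesis .
qed

lemma (in comm_monoid) gfinprod_one:
  assumes "\<And>j. j \<in> A \<Longrightarrow> f j = \<one>"
  shows "gfinprod G f A = \<one>"
  using assms by (simp add: gfinprod_def cong: conj_cong)

section \<open>Categories of functors and of modules\<close>

lemma nat_transD:
  assumes "\<tau> \<in> nat_trans A B F G"
  shows nat_trans_closed: "a \<in> Ob A \<Longrightarrow> \<tau> a \<in> Hom B (FOb F a) (FOb G a)"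
    and nat_trans_extensional: "\<tau> \<in> extensional (Ob A)"
    and nat_trans_natural: "\<lbrakk>a \<in> Ob A; b \<in> Ob A; f \<in> Hom A a b\<rbrakk> \<Longrightarrow>
      Comp B (FOb F a) (FOb F b) (FOb G b) (\<tau> b) (FMor F a b f)
      = Comp B (FOb F a) (FOb G a) (FOb G b) (FMor G a b f) (\<tau> a)"
  using assms by (auto simp: nat_trans_def PiE_iff)

lemma nat_transI:
  assumes "\<And>a. a \<in> Ob A \<Longrightarrow> \<tau> a \<in> Hom B (FOb F a) (FOb G a)"
    and "\<tau> \<in> extensional (Ob A)"
    and "\<And>a b f. \<lbrakk>a \<in> Ob A; b \<in> Ob A; f \<in> Hom A a b\<rbrakk> \<Longrightarrow>
      Comp B (FOb F a) (FOb F b) (FOb G b) (\<tau> b) (FMor F a b f)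
      = Comp B (FOb F a) (FOb G a) (FOb G b) (FMor G a b f) (\<tau> a)"
  shows "\<tau> \<in> nat_trans A B F G"
  using assms by (auto simp: nat_trans_def PiE_iff)

lemma nat_trans_Ident:
  assumes "cat_functor A B F"
  shows "(\<lambda>a \<in> Ob A. Ident B (FOb F a)) \<in> nat_trans A B F F"
proof -
  interpret cat_functor A B F by fact
  show ?thesis
    by (rule nat_transI)
      (auto simp: FOb_closed target.Ident_closed target.Comp_Ident target.Ident_Comp FMor_closed)
qed

lemma nat_trans_Comp:
  assumes "cat_functor A B F" "cat_functor A B G" "cat_functor A B H"
    and \<sigma>: "\<sigma> \<in> nat_trans A B F G" and \<tau>: "\<tau> \<in> nat_trans A B G H"
  shows "(\<lambda>a \<in> Ob A. Comp B (FOb F a) (FOb G a) (FOb H a) (\<tau> a) (\<sigma> a)) \<in> nat_trans A B F H"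
proof -
  interpret F: cat_functor A B F by fact
  interpret G: cat_functor A B G by fact
  interpret H: cat_functor A B H by fact
  note [simp] = F.FOb_closed G.FOb_closed H.FOb_closed F.FMor_closed G.FMor_closed H.FMor_closed
    nat_trans_closed[OF \<sigma>] nat_trans_closed[OF \<tau>]
  show ?thesis
  proof (rule nat_transI)
    fix a b f
    assume f: "a \<in> Ob A" "b \<in> Ob A" "f \<in> Hom A a b"
    let ?c = "\<lambda>X Y Z. Comp B X Y Z"
    have "?c (FOb F a) (FOb F b) (FOb H b) (?c (FOb F b) (FOb G b) (FOb H b) (\<tau> b) (\<sigma> b)) (FMor F a b f)
        = ?c (FOb F a) (FOb G b) (FOb H b) (\<tau> b) (?c (FOb F a) (FOb F b) (FOb G b) (\<sigma> b) (FMor F a b f))"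
      using f by (simp add: F.target.Comp_assoc)
    also have "\<dots> = ?c (FOb F a) (FOb G b) (FOb H b) (\<tau> b) (?c (FOb F a) (FOb G a) (FOb G b) (FMor G a b f) (\<sigma> a))"
      using f by (simp add: nat_trans_natural[OF \<sigma>])
    also have "\<dots> = ?c (FOb F a) (FOb G a) (FOb H b) (?c (FOb G a) (FOb G b) (FOb H b) (\<tau> b) (FMor G a b f)) (\<sigma> a)"
      using f by (simp add: F.target.Comp_assoc)
    also have "\<dots> = ?c (FOb F a) (FOb G a) (FOb H b) (?c (FOb G a) (FOb H a) (FOb H b) (FMor H a b f) (\<tau> a)) (\<sigma> a)"
      using f by (simp add: nat_trans_natural[OF \<tau>])
    also have "\<dots> = ?c (FOb F a) (FOb H a) (FOb H b) (FMor H a b f) (?c (FOb F a) (FOb G a) (FOb H a) (\<tau> a) (\<sigma> a))"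
      using f by (simp add: F.target.Comp_assoc)
    finally show "?c (FOb F a) (FOb F b) (FOb H b)
          ((\<lambda>a\<in>Ob A. ?c (FOb F a) (FOb G a) (FOb H a) (\<tau> a) (\<sigma> a)) b) (FMor F a b f)
        = ?c (FOb F a) (FOb H a) (FOb H b) (FMor H a b f)
          ((\<lambda>a\<in>Ob A. ?c (FOb F a) (FOb G a) (FOb H a) (\<tau> a) (\<sigma> a)) a)"
      using f by simp
  qed (auto simp: F.target.Comp_closed)
qed

lemma category_functor_category: "category (functor_category A B)"
proof
  fix F
  assume "F \<in> Ob (functor_category A B)"
  then interpret linear_functor A B F
    by (simp add: functor_category_def)
  show "Ident (functor_category A B) F \<in> Hom (functor_category A B) F F"
    by (simp add: functor_category_def nat_trans_Ident cat_functor_axioms)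
next
  fix F G H \<sigma> \<tau>
  assume "F \<in> Ob (functor_category A B)" "G \<in> Ob (functor_category A B)"
    "H \<in> Ob (functor_category A B)" "\<sigma> \<in> Hom (functor_category A B) F G"
    "\<tau> \<in> Hom (functor_category A B) G H"
  then show "Comp (functor_category A B) F G H \<tau> \<sigma> \<in> Hom (functor_category A B) F H"
    by (simp add: functor_category_def nat_trans_Comp linear_functor_def)
next
  fix F G \<sigma>
  assume FG: "F \<in> Ob (functor_category A B)" "G \<in> Ob (functor_category A B)"
    and "\<sigma> \<in> Hom (functor_category A B) F G"
  interpret F: linear_functor A B F using FG by (simp add: functor_category_def)
  interpret G: linear_functor A B G using FG by (simp add: functor_category_def)
  have \<sigma>: "\<sigma> \<in> nat_trans A B F G"
    using \<open>\<sigma> \<in> _\<close> by (simp add: functor_category_def)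
  show "Comp (functor_category A B) F F G \<sigma> (Ident (functor_category A B) F) = \<sigma>"
    "Comp (functor_category A B) F G G (Ident (functor_category A B) G) \<sigma> = \<sigma>"
    by (rule extensionalityI[of _ "Ob A"];
      simp add: functor_category_def nat_trans_extensional[OF \<sigma>] nat_trans_closed[OF \<sigma>]
        F.FOb_closed G.FOb_closed F.target.Comp_Ident F.target.Ident_Comp)+
next
  fix F G H K \<sigma> \<tau> \<rho>
  assume FG: "F \<in> Ob (functor_category A B)" "G \<in> Ob (functor_category A B)"
    "H \<in> Ob (functor_category A B)" "K \<in> Ob (functor_category A B)"
    and hom: "\<sigma> \<in> Hom (functor_category A B) F G" "\<tau> \<in> Hom (functor_category A B) G H"
      "\<rho> \<in> Hom (functor_category A B) H K"
  interpret F: linear_functor A B F using FG by (simp add: functor_category_def)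
  interpret G: linear_functor A B G using FG by (simp add: functor_category_def)
  interpret H: linear_functor A B H using FG by (simp add: functor_category_def)
  interpret K: linear_functor A B K using FG by (simp add: functor_category_def)
  show "Comp (functor_category A B) F H K \<rho> (Comp (functor_category A B) F G H \<tau> \<sigma>)
      = Comp (functor_category A B) F G K (Comp (functor_category A B) G H K \<rho> \<tau>) \<sigma>"
    by (rule extensionalityI[of _ "Ob A"])
      (use hom in \<open>auto simp: functor_category_def F.FOb_closed G.FOb_closed H.FOb_closed
          K.FOb_closed nat_trans_closed F.target.Comp_assoc\<close>)
qed

text \<open>The pointwise inverses are natural. This reduces isomorphisms of presheaves to bijections
  of groups.\<close>

lemma isomorphism_functor_category:
  assumes "linear_functor A B F" "linear_functor A B G"
    and \<tau>: "\<tau> \<in> nat_trans A B F G"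
    and iso: "\<And>a. a \<in> Ob A \<Longrightarrow> isomorphism B (FOb F a) (FOb G a) (\<tau> a)"
  shows "isomorphism (functor_category A B) F G \<tau>"
proof -
  interpret F: linear_functor A B F by fact
  interpret G: linear_functor A B G by fact
  let ?c = "\<lambda>X Y Z. Comp B X Y Z"
  have "\<forall>a \<in> Ob A. \<exists>g. g \<in> Hom B (FOb G a) (FOb F a) \<and>
    ?c (FOb F a) (FOb G a) (FOb F a) g (\<tau> a) = Ident B (FOb F a) \<and>
    ?c (FOb G a) (FOb F a) (FOb G a) (\<tau> a) g = Ident B (FOb G a)"
    using iso unfolding isomorphism_def by blast
  then obtain s where s: "\<forall>a \<in> Ob A. s a \<in> Hom B (FOb G a) (FOb F a) \<and>
    ?c (FOb F a) (FOb G a) (FOb F a) (s a) (\<tau> a) = Ident B (FOb F a) \<and>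
    ?c (FOb G a) (FOb F a) (FOb G a) (\<tau> a) (s a) = Ident B (FOb G a)"
    by (rule bchoice[THEN exE])
  define \<sigma> where "\<sigma> = restrict s (Ob A)"
  have \<sigma>: "\<sigma> a \<in> Hom B (FOb G a) (FOb F a) \<and>
    ?c (FOb F a) (FOb G a) (FOb F a) (\<sigma> a) (\<tau> a) = Ident B (FOb F a) \<and>
    ?c (FOb G a) (FOb F a) (FOb G a) (\<tau> a) (\<sigma> a) = Ident B (FOb G a)" if "a \<in> Ob A" for a
    using s that by (simp add: \<sigma>_def)
  have \<sigma>_ext: "\<sigma> \<in> extensional (Ob A)"
    by (simp add: \<sigma>_def)
  note [simp] = F.FOb_closed G.FOb_closed F.FMor_closed G.FMor_closed
    nat_trans_closed[OF \<tau>] conjunct1[OF \<sigma>]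
  have "\<sigma> \<in> nat_trans A B G F"
  proof (rule nat_transI)
    fix a b f
    assume f: "a \<in> Ob A" "b \<in> Ob A" "f \<in> Hom A a b"
    \<comment> \<open>Both sides equal \<open>\<sigma> b \<circ> \<tau> b \<circ> F f \<circ> \<sigma> a = \<sigma> b \<circ> G f \<circ> \<tau> a \<circ> \<sigma> a\<close>.\<close>
    have "?c (FOb G a) (FOb G b) (FOb F b) (\<sigma> b) (FMor G a b f)
        = ?c (FOb G a) (FOb G b) (FOb F b) (\<sigma> b)
          (?c (FOb G a) (FOb G a) (FOb G b) (FMor G a b f)
            (?c (FOb G a) (FOb F a) (FOb G a) (\<tau> a) (\<sigma> a)))"
      using f \<sigma> by (simp add: F.target.Comp_Ident)
    also have "\<dots> = ?c (FOb G a) (FOb G b) (FOb F b) (\<sigma> b)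
          (?c (FOb G a) (FOb F a) (FOb G b)
            (?c (FOb F a) (FOb F b) (FOb G b) (\<tau> b) (FMor F a b f)) (\<sigma> a))"
      using f by (simp add: nat_trans_natural[OF \<tau>] F.target.Comp_assoc)
    also have "\<dots> = ?c (FOb G a) (FOb G b) (FOb F b) (\<sigma> b)
          (?c (FOb G a) (FOb F b) (FOb G b) (\<tau> b)
            (?c (FOb G a) (FOb F a) (FOb F b) (FMor F a b f) (\<sigma> a)))"
      using f by (simp add: F.target.Comp_assoc)
    also have "\<dots> = ?c (FOb G a) (FOb F b) (FOb F b)
          (?c (FOb F b) (FOb G b) (FOb F b) (\<sigma> b) (\<tau> b))
          (?c (FOb G a) (FOb F a) (FOb F b) (FMor F a b f) (\<sigma> a))"
      using f by (intro F.target.Comp_assoc) (auto simp: F.target.Comp_closed)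
    also have "\<dots> = ?c (FOb G a) (FOb F a) (FOb F b) (FMor F a b f) (\<sigma> a)"
      using f \<sigma> by (simp add: F.target.Ident_Comp F.target.Comp_closed)
    finally show "?c (FOb G a) (FOb G b) (FOb F b) (\<sigma> b) (FMor G a b f)
        = ?c (FOb G a) (FOb F a) (FOb F b) (FMor F a b f) (\<sigma> a)" .
  qed (simp_all add: \<sigma>_ext)
  moreover have "(\<lambda>a \<in> Ob A. ?c (FOb F a) (FOb G a) (FOb F a) (\<sigma> a) (\<tau> a))
        = (\<lambda>a \<in> Ob A. Ident B (FOb F a))"
      "(\<lambda>a \<in> Ob A. ?c (FOb G a) (FOb F a) (FOb G a) (\<tau> a) (\<sigma> a))
        = (\<lambda>a \<in> Ob A. Ident B (FOb G a))"
    using \<sigma> by (auto intro: restrict_ext)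
  ultimately show ?thesis
    unfolding isomorphism_def using \<tau> by (auto simp: functor_category_def)
qed

lemma restrict_hom: "f \<in> hom G H \<Longrightarrow> group G \<Longrightarrow> restrict f (carrier G) \<in> hom G H"
  by (rule group.hom_restrict) auto

lemma category_Ab: "category (Ab :: ('u monoid, 'u \<Rightarrow> 'u) linear_category)"
proof
  fix G :: "'u monoid"
  show "Ident Ab G \<in> Hom Ab G G" if "G \<in> Ob Ab"
    using that by (auto simp: Ab_def hom_def comm_groupE(1))
next
  fix G H K L :: "'u monoid" and f g h
  assume G: "G \<in> Ob Ab" and f: "f \<in> Hom Ab G H"
  then have fG: "f \<in> carrier G \<rightarrow> carrier H"
    by (auto simp: Ab_def hom_def)
  show "Comp Ab G H K g f \<in> Hom Ab G K" if "g \<in> Hom Ab H K"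
    using that f G by (auto simp: Ab_def comm_group_def intro: group.hom_compose)
  show "Comp Ab G G H f (Ident Ab G) = f" "Comp Ab G H H (Ident Ab H) f = f"
    using f fG by (auto simp: Ab_def intro: compose_Id Id_compose)
  show "Comp Ab G K L h (Comp Ab G H K g f) = Comp Ab G H L (Comp Ab H K L h g) f"
    using fG by (simp add: Ab_def compose_assoc)
qed

lemma comm_group_hom_group_Ab:
  assumes "comm_group (G :: 'u monoid)" "comm_group H"
  shows "comm_group (hom_group Ab G H)"
proof -
  interpret G: comm_group G by fact
  interpret H: comm_group H by fact
  let ?X = "hom_group Ab G H"
  have carrier: "f \<in> carrier ?X \<longleftrightarrow> f \<in> hom G H \<and> f \<in> extensional (carrier G)" for f
    by (simp add: hom_group_def Ab_def)
  have mult: "f \<otimes>\<^bsub>?X\<^esub> g = (\<lambda>x \<in> carrier G. f x \<otimes>\<^bsub>H\<^esub> g x)" and one: "\<one>\<^bsub>?X\<^esub> = (\<lambda>x \<in> carrier G. \<one>\<^bsub>H\<^esub>)" for f g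
    by (simp_all add: hom_group_def Ab_def)
  have closed: "f x \<in> carrier H" if "f \<in> carrier ?X" "x \<in> carrier G" for f x
    using that by (auto simp: carrier hom_def)
  have eqI: "f = g" if "f \<in> extensional (carrier G)" "g \<in> extensional (carrier G)"
    "\<And>x. x \<in> carrier G \<Longrightarrow> f x = g x" for f g :: "'u \<Rightarrow> 'u"
    using that by (rule extensionalityI)
  show ?thesis
  proof (rule comm_groupI)
    fix f g h
    assume f: "f \<in> carrier ?X" and g: "g \<in> carrier ?X" and h: "h \<in> carrier ?X"
    show "f \<otimes>\<^bsub>?X\<^esub> g \<in> carrier ?X"
      using f g H.hom_group_mult[of f G g] by (auto simp: carrier mult intro!: restrict_hom)
    show "f \<otimes>\<^bsub>?X\<^esub> g \<otimes>\<^bsub>?X\<^esub> h = f \<otimes>\<^bsub>?X\<^esub> (g \<otimes>\<^bsub>?X\<^esub> h)"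
      using f g h by (intro eqI) (simp_all add: mult H.m_assoc closed[OF f] closed[OF g] closed[OF h])
    show "f \<otimes>\<^bsub>?X\<^esub> g = g \<otimes>\<^bsub>?X\<^esub> f"
      using f g by (intro eqI) (simp_all add: mult H.m_comm closed[OF f] closed[OF g])
  next
    fix f
    assume f: "f \<in> carrier ?X"
    show "\<one>\<^bsub>?X\<^esub> \<otimes>\<^bsub>?X\<^esub> f = f"
      using f by (intro eqI) (simp_all add: mult one carrier closed[OF f])
    show "\<exists>g \<in> carrier ?X. g \<otimes>\<^bsub>?X\<^esub> f = \<one>\<^bsub>?X\<^esub>"
    proof
      have "(\<lambda>x. inv\<^bsub>H\<^esub> f x) \<in> hom G H"
        using f closed[OF f] by (auto simp: carrier hom_def H.inv_mult)
      then show "(\<lambda>x \<in> carrier G. inv\<^bsub>H\<^esub> f x) \<in> carrier ?X"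
        by (auto simp: carrier intro!: restrict_hom)
      show "(\<lambda>x \<in> carrier G. inv\<^bsub>H\<^esub> f x) \<otimes>\<^bsub>?X\<^esub> f = \<one>\<^bsub>?X\<^esub>"
        by (intro eqI) (simp_all add: mult one closed[OF f])
    qed
  qed (auto simp: carrier one hom_def)
qed

lemma linear_category_Ab: "linear_category (Ab :: ('u monoid, 'u \<Rightarrow> 'u) linear_category)"
proof (intro linear_category.intro category_Ab linear_category_axioms.intro)
  show "comm_group (hom_group Ab G H)" if "G \<in> Ob Ab" "H \<in> Ob Ab" for G H :: "'u monoid"
    using that by (intro comm_group_hom_group_Ab) (auto simp: Ab_def)
qed (auto simp: Ab_def hom_def Pi_iff compose_def fun_eq_iff comm_groupE(1))

lemma linear_category_opposite:
  assumes "linear_category C"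
  shows "linear_category (opposite C)"
proof -
  interpret linear_category C by fact
  show ?thesis
  proof (intro linear_category.intro category.intro linear_category_axioms.intro)
    show "comm_group (hom_group (opposite C) a b)"
      if "a \<in> Ob (opposite C)" "b \<in> Ob (opposite C)" for a b
      using hom_comm_group[of b a] that by (simp add: opposite_def hom_group_def)
  qed (auto simp: opposite_def Ident_closed Comp_closed Comp_Ident Ident_Comp
        Comp_assoc Comp_hadd_left Comp_hadd_right)
qed

lemma inverse_hom:
  assumes "bij_betw f (carrier G) (carrier H)" "f \<in> hom G H" "group G"
    and "group H"
  shows "restrict (inv_into (carrier G) f) (carrier H) \<in> hom H G"
proof -
  have "inv_into (carrier G) f \<in> hom H G"
    using group.iso_set_sym[OF assms(3), of f H] assms by (simp add: iso_def)
  then show ?thesis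
    using assms(4) by (rule restrict_hom)
qed

lemma isomorphism_Ab:
  assumes "comm_group (G :: 'u monoid)" "comm_group H"
    and f: "f \<in> Hom Ab G H" "bij_betw f (carrier G) (carrier H)"
  shows "isomorphism Ab G H f"
proof -
  let ?g = "restrict (inv_into (carrier G) f) (carrier H)"
  have "?g \<in> hom H G"
    by (rule inverse_hom) (use assms in \<open>auto simp: Ab_def comm_group_def\<close>)
  moreover have "compose (carrier G) ?g f = (\<lambda>x \<in> carrier G. x)"
    "compose (carrier H) f ?g = (\<lambda>x \<in> carrier H. x)"
    using f(2) by (auto simp: compose_def fun_eq_iff bij_betw_inv_into_left bij_betw_inv_into_right
        bij_betwE)
  ultimately show ?thesis
    unfolding isomorphism_def using f by (intro conjI bexI[of _ ?g]) (auto simp: Ab_def)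
qed

lemma category_unital_modules:
  "category (unital_modules R :: (('u, 'r) right_module, 'u \<Rightarrow> 'u) category)"
proof
  fix N :: "('u, 'r) right_module"
  show "Ident (unital_modules R) N \<in> Hom (unital_modules R) N N" if "N \<in> Ob (unital_modules R)"
  proof -
    interpret right_module R N using that by (simp add: unital_modules_def)
    show ?thesis
      by (auto simp: unital_modules_def hom_def act_closed)
  qed
next
  fix N P Q T :: "('u, 'r) right_module" and f g h
  assume N: "N \<in> Ob (unital_modules R)" and f: "f \<in> Hom (unital_modules R) N P"
  interpret right_module R N using N by (simp add: unital_modules_def)
  have fN: "f \<in> carrier N \<rightarrow> carrier P"
    using f by (auto simp: unital_modules_def hom_def)
  show "Comp (unital_modules R) N P Q g f \<in> Hom (unital_modules R) N Q"
    if "g \<in> Hom (unital_modules R) P Q"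
    using that f fN hom_compose[of f P g Q]
    by (simp add: unital_modules_def compose_eq act_closed Pi_iff)
  show "Comp (unital_modules R) N N P f (Ident (unital_modules R) N) = f"
    "Comp (unital_modules R) N P P (Ident (unital_modules R) P) f = f"
    using f fN by (auto simp: unital_modules_def intro: compose_Id Id_compose)
  show "Comp (unital_modules R) N Q T h (Comp (unital_modules R) N P Q g f)
      = Comp (unital_modules R) N P T (Comp (unital_modules R) P Q T h g) f"
    using fN by (simp add: unital_modules_def compose_assoc)
qed

lemma isomorphism_unital_modules:
  assumes N: "N \<in> Ob (unital_modules R)" and P: "P \<in> Ob (unital_modules R)"
    and f: "f \<in> Hom (unital_modules R) N P" "bij_betw f (carrier N) (carrier P)"
  shows "isomorphism (unital_modules R) N P f"
proof -
  interpret N: right_module R N using N by (simp add: unital_modules_def)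
  interpret P: right_module R P using P by (simp add: unital_modules_def)
  let ?g = "restrict (inv_into (carrier N) f) (carrier P)"
  have "?g \<in> hom P N"
    by (rule inverse_hom) (use f N.is_group P.is_group in \<open>auto simp: unital_modules_def\<close>)
  moreover have "?g (act P y r) = act N (?g y) r" if y: "y \<in> carrier P" and r: "r \<in> carrier R" for y r
  proof -
    obtain x where x: "x \<in> carrier N" "y = f x"
      using y f(2) by (auto simp: bij_betw_def)
    have "act P y r = f (act N x r)"
      using f(1) x r by (simp add: unital_modules_def)
    then show ?thesis
      using x y r f(2) P.act_closed[OF y r] by (simp add: bij_betw_inv_into_left N.act_closed)
  qed
  moreover have "compose (carrier N) ?g f = (\<lambda>x \<in> carrier N. x)"
    "compose (carrier P) f ?g = (\<lambda>x \<in> carrier P. x)"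
    using f(2) by (auto simp: compose_def fun_eq_iff bij_betw_inv_into_left bij_betw_inv_into_right
        bij_betwE)
  ultimately show ?thesis
    unfolding isomorphism_def using f by (intro conjI bexI[of _ ?g]) (auto simp: unital_modules_def)
qed

section \<open>Presheaves of abelian groups\<close>

lemma hom_group_simps:
  "carrier (hom_group C a b) = Hom C a b"
  "mult (hom_group C a b) = hadd C a b"
  "one (hom_group C a b) = hzero C a b"
  by (simp_all add: hom_group_def)

text \<open>The axioms of a linear functor \<open>C\<^sup>o\<^sup>p \<rightarrow> Ab\<close>, written out elementwise in terms of \<open>C\<close>,
  so that computations with elements mention neither the opposite category nor composition in \<open>Ab\<close>.\<close>

locale presheaf = linear_category C
  for C :: "('o, 'm) linear_category" +
  fixes M :: "('o, 'm, 'u monoid, 'u \<Rightarrow> 'u) cat_functor"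
  assumes comm_group_FOb: "a \<in> Ob C \<Longrightarrow> comm_group (FOb M a)"
    and FMor_hom: "\<lbrakk>a \<in> Ob C; b \<in> Ob C; f \<in> Hom C a b\<rbrakk>
      \<Longrightarrow> FMor M b a f \<in> hom (FOb M b) (FOb M a)"
    and FMor_extensional: "\<lbrakk>a \<in> Ob C; b \<in> Ob C; f \<in> Hom C a b\<rbrakk>
      \<Longrightarrow> FMor M b a f \<in> extensional (carrier (FOb M b))"
    and FMor_Ident: "\<lbrakk>a \<in> Ob C; x \<in> carrier (FOb M a)\<rbrakk> \<Longrightarrow> FMor M a a (Ident C a) x = x"
    and FMor_Comp: "\<lbrakk>a \<in> Ob C; b \<in> Ob C; c \<in> Ob C; f \<in> Hom C a b; g \<in> Hom C b c;
        x \<in> carrier (FOb M c)\<rbrakk>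
      \<Longrightarrow> FMor M c a (Comp C a b c g f) x = FMor M b a f (FMor M c b g x)"
    and FMor_hadd: "\<lbrakk>a \<in> Ob C; b \<in> Ob C; f \<in> Hom C a b; g \<in> Hom C a b; x \<in> carrier (FOb M b)\<rbrakk>
      \<Longrightarrow> FMor M b a (hadd C a b f g) x = FMor M b a f x \<otimes>\<^bsub>FOb M a\<^esub> FMor M b a g x"

lemma presheaf_iff_linear_functor:
  assumes "linear_category C"
  shows "presheaf C M \<longleftrightarrow> linear_functor (opposite C) Ab M"
proof
  assume "presheaf C M"
  then interpret presheaf C M .
  have eqI: "f = g" if "f \<in> extensional X" "g \<in> extensional X" "\<And>x. x \<in> X \<Longrightarrow> f x = g x"
    for f g :: "'c \<Rightarrow> 'c" and X
    using that by (rule extensionalityI)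
  note [simp] = comm_group_FOb FMor_hom FMor_extensional Comp_closed Ident_closed
    hom_in_carrier[OF FMor_hom]
  have hadd_closed: "hadd C a b f g \<in> Hom C a b"
    if "a \<in> Ob C" "b \<in> Ob C" "f \<in> Hom C a b" "g \<in> Hom C a b" for a b f g
    using comm_groupE(1)[OF hom_comm_group[OF that(1,2)]] that by (simp add: hom_group_simps)
  show "linear_functor (opposite C) Ab M"
  proof (intro linear_functor.intro cat_functor.intro cat_functor_axioms.intro
      linear_functor_axioms.intro linear_category_opposite[OF assms] linear_category_Ab
      linear_category.axioms(1)[OF linear_category_opposite[OF assms]] category_Ab)
    fix a
    assume "a \<in> Ob (opposite C)"
    then show "FMor M a a (Ident (opposite C) a) = Ident Ab (FOb M a)"
      by (intro eqI[of _ "carrier (FOb M a)"]) (auto simp: opposite_def Ab_def FMor_Ident)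
  next
    fix a b c f g
    assume "a \<in> Ob (opposite C)" "b \<in> Ob (opposite C)" "c \<in> Ob (opposite C)"
      "f \<in> Hom (opposite C) a b" "g \<in> Hom (opposite C) b c"
    then show "FMor M a c (Comp (opposite C) a b c g f)
        = Comp Ab (FOb M a) (FOb M b) (FOb M c) (FMor M b c g) (FMor M a b f)"
      by (intro eqI[of _ "carrier (FOb M a)"])
        (auto simp: opposite_def Ab_def FMor_Comp compose_eq)
  next
    fix a b
    assume ab: "a \<in> Ob (opposite C)" "b \<in> Ob (opposite C)"
    show "FMor M a b \<in> hom (hom_group (opposite C) a b) (hom_group Ab (FOb M a) (FOb M b))"
    proof (rule homI)
      fix f g
      assume fg: "f \<in> carrier (hom_group (opposite C) a b)" "g \<in> carrier (hom_group (opposite C) a b)"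
      show "FMor M a b (f \<otimes>\<^bsub>hom_group (opposite C) a b\<^esub> g)
          = FMor M a b f \<otimes>\<^bsub>hom_group Ab (FOb M a) (FOb M b)\<^esub> FMor M a b g"
        using ab fg by (intro eqI[of _ "carrier (FOb M a)"])
          (auto simp: opposite_def Ab_def hom_group_simps FMor_hadd hadd_closed)
    qed (use ab in \<open>auto simp: opposite_def Ab_def hom_group_simps\<close>)
  qed (auto simp: opposite_def Ab_def)
next
  assume "linear_functor (opposite C) Ab M"
  then interpret M: linear_functor "opposite C" Ab M .
  have hom: "FMor M b a f \<in> hom (FOb M b) (FOb M a) \<inter> extensional (carrier (FOb M b))"
    if "a \<in> Ob C" "b \<in> Ob C" "f \<in> Hom C a b" for a b f
    using M.FMor_closed[of b a f] that by (simp add: opposite_def Ab_def)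
  show "presheaf C M"
  proof (intro presheaf.intro assms presheaf_axioms.intro)
    show "comm_group (FOb M a)" if "a \<in> Ob C" for a
      using M.FOb_closed[of a] that by (simp add: opposite_def Ab_def)
    show "FMor M a a (Ident C a) x = x" if "a \<in> Ob C" "x \<in> carrier (FOb M a)" for a x
      using M.FMor_Ident[of a] that by (simp add: opposite_def Ab_def)
    show "FMor M c a (Comp C a b c g f) x = FMor M b a f (FMor M c b g x)"
      if "a \<in> Ob C" "b \<in> Ob C" "c \<in> Ob C" "f \<in> Hom C a b" "g \<in> Hom C b c"
        "x \<in> carrier (FOb M c)" for a b c f g x
      using M.FMor_Comp[of c b a g f] that by (simp add: opposite_def Ab_def compose_eq)
    show "FMor M b a (hadd C a b f g) x = FMor M b a f x \<otimes>\<^bsub>FOb M a\<^esub> FMor M b a g x"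
      if "a \<in> Ob C" "b \<in> Ob C" "f \<in> Hom C a b" "g \<in> Hom C a b" "x \<in> carrier (FOb M b)" for a b f g x
      using hom_mult[OF M.FMor_hom[of b a], of f g] that
      by (simp add: opposite_def Ab_def hom_group_simps)
  qed (use hom in auto)
qed

text \<open>The additive group of \<^const>\<open>category_ring\<close>, presented as a direct sum so that the results on
  homomorphisms out of direct sums apply.\<close>

abbreviation ring_group :: "('o, 'm) linear_category \<Rightarrow> ('o \<times> 'o \<Rightarrow> 'm) monoid" where
  "ring_group C \<equiv> sum_group (Ob C \<times> Ob C) (\<lambda>(a, b). hom_group C b a)"

lemma carrier_category_ring: "carrier (category_ring C) = carrier (ring_group C)"
  and add_category_ring: "add (category_ring C) = mult (ring_group C)"
  and zero_category_ring: "zero (category_ring C) = one (ring_group C)"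
  by (simp_all add: category_ring_def Let_def)

lemma add_monoid_category_ring: "add_monoid (category_ring C) = ring_group C"
  by (rule monoid.equality)
    (simp_all add: carrier_category_ring add_category_ring zero_category_ring)

lemma single_eq_sum_inj:
  "single C a b f = sum_inj (Ob C \<times> Ob C) (\<lambda>(a, b). hom_group C b a) (b, a) f"
  by (auto simp: single_def sum_inj_def fun_eq_iff hom_group_simps)

lemma direct_sum_module_simps [simp]:
  "carrier (direct_sum_module C M) = carrier (sum_group (Ob C) (FOb M))"
  "mult (direct_sum_module C M) = mult (sum_group (Ob C) (FOb M))"
  "one (direct_sum_module C M) = one (sum_group (Ob C) (FOb M))"
  by (simp_all add: direct_sum_module_def Let_def)

lemma act_direct_sum_module:
  "act (direct_sum_module C M) m f = (\<lambda>a \<in> Ob C.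
     gfinprod (FOb M a) (\<lambda>b. FMor M b a (f (b, a)) (m b)) (Ob C))"
  by (simp add: direct_sum_module_def Let_def)

context linear_category
begin

lemma group_hom_group: "\<lbrakk>a \<in> Ob C; b \<in> Ob C\<rbrakk> \<Longrightarrow> group (hom_group C a b)"
  using hom_comm_group by (simp add: comm_group_def)

lemma hzero_closed: "\<lbrakk>a \<in> Ob C; b \<in> Ob C\<rbrakk> \<Longrightarrow> hzero C a b \<in> Hom C a b"
  using comm_groupE(2)[OF hom_comm_group] by (simp add: hom_group_simps)

end

text \<open>This locale restricts \<open>C\<close> to the unextended record type, for which \<^const>\<open>opposite\<close> and
  \<^const>\<open>category_ring\<close> are defined.\<close>

locale small_linear_category = linear_category C
  for C :: "('o, 'm) linear_category"
begin

abbreviation R :: "('o \<times> 'o \<Rightarrow> 'm) ring" where "R \<equiv> category_ring C"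

lemma group_ring_summand: "p \<in> Ob C \<times> Ob C \<Longrightarrow> group (case p of (a, b) \<Rightarrow> hom_group C b a)"
  by (auto intro: group_hom_group)

lemma group_ring_group: "group (ring_group C)"
  by (rule sum_group) (rule group_ring_summand)

lemma ring_group_iff:
  "f \<in> carrier (ring_group C) \<longleftrightarrow> f \<in> extensional (Ob C \<times> Ob C) \<and>
     (\<forall>a \<in> Ob C. \<forall>b \<in> Ob C. f (a, b) \<in> Hom C b a) \<and>
     finite {p \<in> Ob C \<times> Ob C. f p \<noteq> hzero C (snd p) (fst p)}"
  using carrier_sum_group[of "Ob C \<times> Ob C" "\<lambda>(a, b). hom_group C b a", OF group_ring_summand]
  by (auto simp: PiE_iff hom_group_simps split_beta)

lemma ring_component:
  "\<lbrakk>f \<in> carrier (ring_group C); a \<in> Ob C; b \<in> Ob C\<rbrakk> \<Longrightarrow> f (a, b) \<in> Hom C b a"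
  by (simp add: ring_group_iff)

lemma single_closed:
  "\<lbrakk>a \<in> Ob C; b \<in> Ob C; f \<in> Hom C a b\<rbrakk> \<Longrightarrow> single C a b f \<in> carrier (ring_group C)"
  unfolding single_eq_sum_inj
  by (rule sum_inj_closed) (auto intro: group_hom_group simp: hom_group_simps)

end

sublocale presheaf \<subseteq> small_linear_category C ..

section \<open>The action on the direct sum of a presheaf\<close>

context presheaf
begin

abbreviation S :: "('o \<Rightarrow> 'u) monoid" where "S \<equiv> sum_group (Ob C) (FOb M)"
abbreviation D :: "('o \<Rightarrow> 'u, 'o \<times> 'o \<Rightarrow> 'm) right_module" where "D \<equiv> direct_sum_module C M"

lemma group_FOb: "a \<in> Ob C \<Longrightarrow> group (FOb M a)"
  using comm_group_FOb by (simp add: comm_group_def)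

lemma group_S: "group S"
  by (simp add: group_FOb)

lemma S_iff:
  "m \<in> carrier S \<longleftrightarrow> m \<in> extensional (Ob C) \<and> (\<forall>a \<in> Ob C. m a \<in> carrier (FOb M a)) \<and>
     finite {a \<in> Ob C. m a \<noteq> \<one>\<^bsub>FOb M a\<^esub>}"
  using carrier_sum_group[of "Ob C" "FOb M", OF group_FOb] by (auto simp: PiE_iff)

lemma S_component: "\<lbrakk>m \<in> carrier S; a \<in> Ob C\<rbrakk> \<Longrightarrow> m a \<in> carrier (FOb M a)"
  by (simp add: S_iff)

lemma FMor_closed:
  "\<lbrakk>a \<in> Ob C; b \<in> Ob C; f \<in> Hom C a b; x \<in> carrier (FOb M b)\<rbrakk> \<Longrightarrow> FMor M b a f x \<in> carrier (FOb M a)"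
  by (rule hom_in_carrier[OF FMor_hom])

lemma FMor_one: "\<lbrakk>a \<in> Ob C; b \<in> Ob C; f \<in> Hom C a b\<rbrakk> \<Longrightarrow> FMor M b a f \<one>\<^bsub>FOb M b\<^esub> = \<one>\<^bsub>FOb M a\<^esub>"
  by (rule hom_one[OF FMor_hom]) (auto simp: group_FOb)

lemma FMor_apply_hom:
  assumes "a \<in> Ob C" "b \<in> Ob C" "x \<in> carrier (FOb M b)"
  shows "(\<lambda>f. FMor M b a f x) \<in> hom (hom_group C a b) (FOb M a)"
  by (rule homI) (use assms in \<open>auto simp: hom_group_simps FMor_closed FMor_hadd\<close>)

lemma FMor_hzero:
  assumes "a \<in> Ob C" "b \<in> Ob C" "x \<in> carrier (FOb M b)"
  shows "FMor M b a (hzero C a b) x = \<one>\<^bsub>FOb M a\<^esub>"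
  using hom_one[OF FMor_apply_hom[OF assms]] assms
  by (simp add: group_hom_group group_FOb) (simp add: hom_group_simps)

lemma act_eq_one:
  assumes m: "m \<in> carrier S" and a: "a \<in> Ob C" and "\<And>b. b \<in> Ob C \<Longrightarrow> f (b, a) = hzero C a b"
  shows "act D m f a = \<one>\<^bsub>FOb M a\<^esub>"
proof -
  interpret comm_group "FOb M a" using a by (rule comm_group_FOb)
  show ?thesis
    using assms by (auto simp: act_direct_sum_module S_iff FMor_hzero intro!: gfinprod_one)
qed

text \<open>The action of \<open>f\<close> can only be nonzero at the sources of the finitely many nonzero entries of
  \<open>f\<close>.\<close>

lemma act_closed:
  assumes m: "m \<in> carrier S" and f: "f \<in> carrier (ring_group C)"
  shows "act D m f \<in> carrier S"
proof -
  let ?F = "{p \<in> Ob C \<times> Ob C. f p \<noteq> hzero C (snd p) (fst p)}"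
  have "{a \<in> Ob C. act D m f a \<noteq> \<one>\<^bsub>FOb M a\<^esub>} \<subseteq> snd ` ?F"
  proof
    fix a
    assume a: "a \<in> {a \<in> Ob C. act D m f a \<noteq> \<one>\<^bsub>FOb M a\<^esub>}"
    then obtain b where "b \<in> Ob C" "f (b, a) \<noteq> hzero C a b"
      using act_eq_one[OF m, of a f] by auto
    then show "a \<in> snd ` ?F"
      using a by (intro image_eqI[of _ _ "(b, a)"]) auto
  qed
  moreover have "finite ?F"
    using f by (simp add: ring_group_iff)
  ultimately have "finite {a \<in> Ob C. act D m f a \<noteq> \<one>\<^bsub>FOb M a\<^esub>}"
    by (meson finite_imageI finite_subset)
  moreover have "act D m f a \<in> carrier (FOb M a)" if a: "a \<in> Ob C" for a
  proof -
    interpret comm_group "FOb M a" using a by (rule comm_group_FOb)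
    show ?thesis
      using a m f by (auto simp: act_direct_sum_module S_iff ring_group_iff FMor_closed
          intro!: gfinprod_closed)
  qed
  ultimately show ?thesis
    by (simp add: S_iff) (simp add: act_direct_sum_module)
qed

lemma act_hom_left:
  assumes f: "f \<in> carrier (ring_group C)"
  shows "(\<lambda>m. act D m f) \<in> hom S S"
proof (rule sum_group_homI)
  fix a
  assume a: "a \<in> Ob C"
  then interpret comm_group "FOb M a" by (rule comm_group_FOb)
  have "(\<lambda>m. gfinprod (FOb M a) (\<lambda>b. FMor M b a (f (b, a)) (m b)) (Ob C)) \<in> hom S (FOb M a)"
    by (rule hom_group_sum) (use a f in \<open>auto simp: ring_group_iff intro: FMor_hom group_FOb\<close>)
  then show "(\<lambda>m. act D m f a) \<in> hom S (FOb M a)"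
    using a by (simp add: act_direct_sum_module)
qed (auto simp: group_FOb act_closed[OF _ f])

lemma act_hom_right:
  assumes m: "m \<in> carrier S"
  shows "act D m \<in> hom (ring_group C) S"
proof (rule sum_group_homI)
  fix a
  assume a: "a \<in> Ob C"
  interpret comm_group "FOb M a" using a by (rule comm_group_FOb)
  \<comment> \<open>The component at \<open>a\<close> depends on the column \<open>b \<mapsto> f (b, a)\<close> only.\<close>
  let ?T = "sum_group (Ob C) (hom_group C a)"
  let ?col = "\<lambda>f. \<lambda>b \<in> Ob C. f (b, a)"
  let ?h = "\<lambda>x. gfinprod (FOb M a) (\<lambda>b. FMor M b a (x b) (m b)) (Ob C)"
  have "?h \<in> hom ?T (FOb M a)"
    by (rule hom_group_sum) (use a m in \<open>auto simp: S_iff intro: FMor_apply_hom group_hom_group\<close>)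
  moreover have "?col \<in> hom (ring_group C) ?T"
  proof (rule sum_group_homI)
    fix f
    assume f: "f \<in> carrier (ring_group C)"
    let ?F = "{p \<in> Ob C \<times> Ob C. f p \<noteq> hzero C (snd p) (fst p)}"
    have "{b \<in> Ob C. f (b, a) \<noteq> hzero C a b} \<subseteq> fst ` ?F"
      using a by (auto intro!: image_eqI[of _ fst "(_, a)"])
    moreover have "finite ?F"
      using f by (simp add: ring_group_iff)
    ultimately have "finite {b \<in> Ob C. f (b, a) \<noteq> hzero C a b}"
      by (meson finite_imageI finite_subset)
    then show "?col f \<in> carrier ?T"
      using a f by (subst carrier_sum_group)
        (auto simp: group_hom_group ring_group_iff hom_group_simps cong: conj_cong)
  next
    show "(\<lambda>f. ?col f b) \<in> hom (ring_group C) (hom_group C a b)" if "b \<in> Ob C" for b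
      by (rule homI) (use a that in \<open>auto simp: ring_component\<close>, simp add: hom_group_simps ring_component)
  qed (use a group_ring_group in \<open>auto intro: group_hom_group\<close>)
  ultimately have "?h \<circ> ?col \<in> hom (ring_group C) (FOb M a)"
    by (rule Group.hom_compose[rotated])
  moreover have "(?h \<circ> ?col) f = act D m f a" if "f \<in> carrier (ring_group C)" for f
    using a m that unfolding o_def act_direct_sum_module restrict_apply'[OF a]
    by (intro gfinprod_cong) (auto simp: S_iff ring_component FMor_closed simp_implies_def)
  ultimately show "(\<lambda>f. act D m f a) \<in> hom (ring_group C) (FOb M a)"
    by (rule group.hom_restrict[OF group_ring_group])
qed (auto simp: group_FOb group_ring_group act_closed[OF m])

text \<open>The formula \<open>m \<cdot> f = M(f)(m)\<close>; together with biadditivity it determines the action.\<close>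

lemma act_single:
  assumes m: "m \<in> carrier S" and ab: "a \<in> Ob C" "b \<in> Ob C" and f: "f \<in> Hom C a b"
  shows "act D m (single C a b f) = sum_inj (Ob C) (FOb M) a (FMor M b a f (m b))"
proof (rule sum_group_eqI[OF group_FOb])
  show "act D m (single C a b f) \<in> carrier S"
    using assms by (simp add: act_closed single_closed)
  show "sum_inj (Ob C) (FOb M) a (FMor M b a f (m b)) \<in> carrier S"
    using assms by (intro sum_inj_closed) (auto simp: group_FOb S_iff FMor_closed)
next
  fix c
  assume c: "c \<in> Ob C"
  then interpret comm_group "FOb M c" by (rule comm_group_FOb)
  show "act D m (single C a b f) c = sum_inj (Ob C) (FOb M) a (FMor M b a f (m b)) c"
  proof (cases "c = a")
    case True
    have "gfinprod (FOb M c) (\<lambda>d. FMor M d c (single C a b f (d, c)) (m d)) (Ob C)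
        = FMor M b c (single C a b f (b, c)) (m b)"
      by (rule gfinprod_singleton) (use assms True in \<open>auto simp: single_def FMor_closed FMor_hzero S_iff\<close>)
    then show ?thesis
      using assms True by (simp add: act_direct_sum_module sum_inj_def single_def)
  next
    case False
    then show ?thesis
      using act_eq_one[OF m c, of "single C a b f"] c by (auto simp: sum_inj_def single_def)
  qed
qed auto

end

section \<open>The ring of a linear category\<close>

definition representable ::
    "('o, 'm) linear_category \<Rightarrow> 'o \<Rightarrow> ('o, 'm, 'm monoid, 'm \<Rightarrow> 'm) cat_functor" where
  "representable C p =
     \<lparr>FOb = (\<lambda>a. hom_group C a p), FMor = (\<lambda>b a g. \<lambda>f \<in> Hom C b p. Comp C a b p f g)\<rparr>"

lemma representable_simps [simp]:
  "FOb (representable C p) a = hom_group C a p"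
  "FMor (representable C p) b a g = (\<lambda>f \<in> Hom C b p. Comp C a b p f g)"
  by (simp_all add: representable_def)

definition row :: "('o, 'm) linear_category \<Rightarrow> 'o \<Rightarrow> ('o \<times> 'o \<Rightarrow> 'm) \<Rightarrow> 'o \<Rightarrow> 'm" where
  "row C p f = (\<lambda>a \<in> Ob C. f (p, a))"

context small_linear_category
begin

lemma presheaf_representable:
  assumes p: "p \<in> Ob C"
  shows "presheaf C (representable C p)"
proof (intro presheaf.intro presheaf_axioms.intro linear_category_axioms)
  show "FMor (representable C p) b a f \<in> hom (FOb (representable C p) b) (FOb (representable C p) a)"
    if "a \<in> Ob C" "b \<in> Ob C" "f \<in> Hom C a b" for a b f
  proof -
    have "hadd C b p g h \<in> Hom C b p" if "g \<in> Hom C b p" "h \<in> Hom C b p" for g h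
      using comm_groupE(1)[OF hom_comm_group[OF \<open>b \<in> Ob C\<close> p]] that by (simp add: hom_group_simps)
    then show ?thesis
      using that p by (auto intro!: homI simp: hom_group_simps Comp_closed Comp_hadd_left)
  qed
qed (use p in \<open>auto simp: hom_group_simps Comp_closed Comp_Ident Comp_assoc Comp_hadd_right hom_comm_group\<close>)

lemma row_hom:
  assumes p: "p \<in> Ob C"
  shows "row C p \<in> hom (ring_group C) (sum_group (Ob C) (FOb (representable C p)))"
proof (rule sum_group_homI)
  interpret P: presheaf C "representable C p"
    using p by (rule presheaf_representable)
  fix f
  assume f: "f \<in> carrier (ring_group C)"
  let ?F = "{q \<in> Ob C \<times> Ob C. f q \<noteq> hzero C (snd q) (fst q)}"
  have "{b \<in> Ob C. f (p, b) \<noteq> hzero C b p} \<subseteq> snd ` ?F"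
    using p by (auto intro!: image_eqI[of _ snd "(p, _)"])
  moreover have "finite ?F"
    using f by (simp add: ring_group_iff)
  ultimately have "finite {b \<in> Ob C. f (p, b) \<noteq> hzero C b p}"
    by (meson finite_imageI finite_subset)
  then show "row C p f \<in> carrier P.S"
    using p f unfolding P.S_iff by (auto simp: row_def ring_group_iff hom_group_simps cong: conj_cong)
next
  show "(\<lambda>f. row C p f b) \<in> hom (ring_group C) (FOb (representable C p) b)" if "b \<in> Ob C" for b
    using p that by (auto intro!: homI simp: row_def ring_component hom_group_simps)
qed (use p group_ring_group in \<open>auto intro: group_hom_group\<close>)

lemma row_closed:
  "\<lbrakk>p \<in> Ob C; f \<in> carrier (ring_group C)\<rbrakk>
    \<Longrightarrow> row C p f \<in> carrier (sum_group (Ob C) (FOb (representable C p)))"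
  by (rule hom_in_carrier[OF row_hom])

text \<open>The rows of a product \<open>f g\<close> arise from the rows of \<open>f\<close> by the right action of \<open>g\<close> on the
  direct sums of representable presheaves. So the ring axioms are instances of the
  corresponding properties of that action.\<close>

lemma ring_mult_component:
  assumes "p \<in> Ob C" "q \<in> Ob C" and f: "f \<in> carrier (ring_group C)" and g: "g \<in> carrier (ring_group C)"
  shows "(f \<otimes>\<^bsub>R\<^esub> g) (p, q) = act (direct_sum_module C (representable C p)) (row C p f) g q"
proof -
  interpret comm_group "hom_group C q p"
    using assms by (intro hom_comm_group)
  have "gfinprod (hom_group C q p) (\<lambda>c. Comp C q c p (f (p, c)) (g (c, q))) (Ob C)
      = gfinprod (hom_group C q p) (\<lambda>c. (\<lambda>h \<in> Hom C c p. Comp C q c p h (g (c, q))) (row C p f c)) (Ob C)"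
    using assms by (intro gfinprod_cong)
      (auto simp: row_def ring_component Comp_closed hom_group_simps simp_implies_def)
  then show ?thesis
    using assms by (simp add: category_ring_def Let_def act_direct_sum_module)
qed

text \<open>The product vanishes at \<open>(p, q)\<close> unless row \<open>p\<close> of \<open>f\<close> and column \<open>q\<close> of \<open>g\<close> are nonzero, and
  there are finitely many such rows and columns.\<close>

lemma ring_mult_closed:
  assumes f: "f \<in> carrier (ring_group C)" and g: "g \<in> carrier (ring_group C)"
  shows "f \<otimes>\<^bsub>R\<^esub> g \<in> carrier (ring_group C)"
proof -
  let ?F = "\<lambda>f. {p \<in> Ob C \<times> Ob C. f p \<noteq> hzero C (snd p) (fst p)}"
  have comp: "(f \<otimes>\<^bsub>R\<^esub> g) (p, q) \<in> Hom C q p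
      \<and> ((f \<otimes>\<^bsub>R\<^esub> g) (p, q) \<noteq> hzero C q p \<longrightarrow> (p, q) \<in> fst ` ?F f \<times> snd ` ?F g)"
    if pq: "p \<in> Ob C" "q \<in> Ob C" for p q
  proof -
    interpret P: presheaf C "representable C p"
      using pq(1) by (rule presheaf_representable)
    let ?m = "act P.D (row C p f) g"
    have row: "row C p f \<in> carrier P.S"
      using pq(1) f by (rule row_closed)
    have "?m q = hzero C q p" if "p \<notin> fst ` ?F f"
    proof -
      have "f (p, b) = hzero C b p" if "b \<in> Ob C" for b
        using \<open>p \<notin> fst ` ?F f\<close> that pq by force
      then have "row C p f = \<one>\<^bsub>P.S\<^esub>"
        by (auto simp: row_def hom_group_simps)
      then show ?thesis
        using hom_one[OF P.act_hom_left[OF g] P.group_S P.group_S] pq by (simp add: hom_group_simps)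
    qed
    moreover have "?m q = hzero C q p" if "q \<notin> snd ` ?F g"
    proof -
      have "g (b, q) = hzero C q b" if "b \<in> Ob C" for b
        using \<open>q \<notin> snd ` ?F g\<close> that pq by force
      then show ?thesis
        using P.act_eq_one[OF row pq(2)] by (simp add: hom_group_simps)
    qed
    moreover have "?m q \<in> Hom C q p"
      using P.act_closed[OF row g] pq by (simp add: P.S_iff hom_group_simps)
    ultimately show ?thesis
      using ring_mult_component[OF pq f g] by auto
  qed
  have "?F (f \<otimes>\<^bsub>R\<^esub> g) \<subseteq> fst ` ?F f \<times> snd ` ?F g"
    using comp by auto
  moreover have "finite (?F f)" "finite (?F g)"
    using f g by (simp_all add: ring_group_iff)
  ultimately have "finite (?F (f \<otimes>\<^bsub>R\<^esub> g))"
    by (meson finite_SigmaI finite_imageI finite_subset)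
  then show ?thesis
    using comp by (simp add: ring_group_iff) (simp add: category_ring_def Let_def)
qed

lemma ring_mult_hom_left:
  assumes g: "g \<in> carrier (ring_group C)"
  shows "(\<lambda>f. f \<otimes>\<^bsub>R\<^esub> g) \<in> hom (ring_group C) (ring_group C)"
proof (rule sum_group_homI)
  fix i
  assume "i \<in> Ob C \<times> Ob C"
  then obtain p q where i: "i = (p, q)" "p \<in> Ob C" "q \<in> Ob C" by auto
  interpret P: presheaf C "representable C p"
    using i(2) by (rule presheaf_representable)
  have "(\<lambda>m. m q) \<circ> ((\<lambda>m. act P.D m g) \<circ> row C p) \<in> hom (ring_group C) (hom_group C q p)"
    using row_hom[OF i(2)] P.act_hom_left[OF g] sum_group_proj_hom[of "Ob C" "FOb (representable C p)" q, OF P.group_FOb i(3)]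
    by (auto intro!: Group.hom_compose)
  then show "(\<lambda>f. (f \<otimes>\<^bsub>R\<^esub> g) i) \<in> hom (ring_group C) (case i of (a, b) \<Rightarrow> hom_group C b a)"
    unfolding i(1) prod.case
    by (rule group.hom_restrict[OF group_ring_group])
      (use i g in \<open>simp add: ring_mult_component\<close>)
qed (auto intro: group_ring_group group_hom_group ring_mult_closed g)

lemma ring_mult_hom_right:
  assumes f: "f \<in> carrier (ring_group C)"
  shows "(\<lambda>g. f \<otimes>\<^bsub>R\<^esub> g) \<in> hom (ring_group C) (ring_group C)"
proof (rule sum_group_homI)
  fix i
  assume "i \<in> Ob C \<times> Ob C"
  then obtain p q where i: "i = (p, q)" "p \<in> Ob C" "q \<in> Ob C" by auto
  interpret P: presheaf C "representable C p"
    using i(2) by (rule presheaf_representable)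
  have "(\<lambda>m. m q) \<circ> act P.D (row C p f) \<in> hom (ring_group C) (hom_group C q p)"
    using P.act_hom_right[OF row_closed[OF i(2) f]] sum_group_proj_hom[of "Ob C" "FOb (representable C p)" q, OF P.group_FOb i(3)]
    by (auto intro!: Group.hom_compose)
  then show "(\<lambda>g. (f \<otimes>\<^bsub>R\<^esub> g) i) \<in> hom (ring_group C) (case i of (a, b) \<Rightarrow> hom_group C b a)"
    unfolding i(1) prod.case
    by (rule group.hom_restrict[OF group_ring_group])
      (use i f in \<open>simp add: ring_mult_component\<close>)
qed (auto intro: group_ring_group group_hom_group ring_mult_closed f)

lemma ring_mult_single:
  assumes f: "f \<in> carrier (ring_group C)" and ab: "a \<in> Ob C" "b \<in> Ob C" "h \<in> Hom C a b"
    and pq: "p \<in> Ob C" "q \<in> Ob C"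
  shows "(f \<otimes>\<^bsub>R\<^esub> single C a b h) (p, q) = (if q = a then Comp C a b p (f (p, b)) h else hzero C q p)"
proof -
  interpret P: presheaf C "representable C p"
    using pq(1) by (rule presheaf_representable)
  show ?thesis
    using assms by (simp add: ring_mult_component single_closed P.act_single row_closed)
      (simp add: sum_inj_def row_def ring_component hom_group_simps)
qed

lemma Comp_hzero:
  assumes "a \<in> Ob C" "b \<in> Ob C" "c \<in> Ob C" "f \<in> Hom C a b"
  shows "Comp C a b c (hzero C b c) f = hzero C a c"
proof -
  interpret P: presheaf C "representable C c"
    using assms(3) by (rule presheaf_representable)
  show ?thesis
    using P.FMor_one[OF assms(1,2,4)] assms by (simp add: hom_group_simps hzero_closed)
qed

lemma single_mult_single:
  assumes "a \<in> Ob C" "b \<in> Ob C" "b' \<in> Ob C" "c \<in> Ob C" "f \<in> Hom C a b" "g \<in> Hom C b' c"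
  shows "single C b' c g \<otimes>\<^bsub>R\<^esub> single C a b f =
    (if b = b' then single C a c (Comp C a b c g f) else \<zero>\<^bsub>R\<^esub>)"
proof (rule extensionalityI)
  show "single C b' c g \<otimes>\<^bsub>R\<^esub> single C a b f \<in> extensional (Ob C \<times> Ob C)"
    using ring_mult_closed[OF single_closed single_closed] assms by (auto simp: ring_group_iff)
  show "(if b = b' then single C a c (Comp C a b c g f) else \<zero>\<^bsub>R\<^esub>) \<in> extensional (Ob C \<times> Ob C)"
    by (simp add: single_def zero_category_ring)
  show "(single C b' c g \<otimes>\<^bsub>R\<^esub> single C a b f) i
      = (if b = b' then single C a c (Comp C a b c g f) else \<zero>\<^bsub>R\<^esub>) i"
    if "i \<in> Ob C \<times> Ob C" for i
    using that assms
    by (auto simp: ring_mult_single single_closed) 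
      (auto simp: single_def zero_category_ring hom_group_simps Comp_hzero)
qed

end

section \<open>Direct sums as modules\<close>

context presheaf
begin

lemma sum_inj_closed_S:
  "\<lbrakk>a \<in> Ob C; x \<in> carrier (FOb M a)\<rbrakk> \<Longrightarrow> sum_inj (Ob C) (FOb M) a x \<in> carrier S"
  by (rule sum_inj_closed) (auto simp: group_FOb)

lemma act_zero: "m \<in> carrier S \<Longrightarrow> act D m \<zero>\<^bsub>R\<^esub> = \<one>\<^bsub>S\<^esub>"
  unfolding zero_category_ring by (rule hom_one[OF act_hom_right group_ring_group group_S])

text \<open>Both sides are additive in \<open>f\<close> and \<open>g\<close>, so it suffices to consider single morphisms, where
  the claim is functoriality of \<open>M\<close>.\<close>

lemma act_mult:
  assumes m: "m \<in> carrier S" and f: "f \<in> carrier (ring_group C)" and g: "g \<in> carrier (ring_group C)"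
  shows "act D m (f \<otimes>\<^bsub>R\<^esub> g) = act D (act D m f) g"
proof -
  have "act D m (single C a b h \<otimes>\<^bsub>R\<^esub> g) = act D (act D m (single C a b h)) g"
    if ab: "a \<in> Ob C" "b \<in> Ob C" "h \<in> Hom C a b" for a b h
  proof (rule sum_group_hom_eq[where h = "\<lambda>g. act D m (single C a b h \<otimes>\<^bsub>R\<^esub> g)",
        OF group_ring_summand group_S _ _ _ g])
    have s: "single C a b h \<in> carrier (ring_group C)"
      using ab by (rule single_closed)
    show "(\<lambda>g. act D m (single C a b h \<otimes>\<^bsub>R\<^esub> g)) \<in> hom (ring_group C) S"
      using Group.hom_compose[OF ring_mult_hom_right[OF s] act_hom_right[OF m]] by (simp add: o_def)
    show "act D (act D m (single C a b h)) \<in> hom (ring_group C) S"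
      by (rule act_hom_right[OF act_closed[OF m s]])
  next
    fix i k
    assume "i \<in> Ob C \<times> Ob C" "k \<in> carrier (case i of (a, b) \<Rightarrow> hom_group C b a)"
    then obtain d c where i: "i = (d, c)" and cd: "c \<in> Ob C" "d \<in> Ob C" "k \<in> Hom C c d"
      by (auto simp: hom_group_simps)
    have mb: "m b \<in> carrier (FOb M b)"
      using m ab by (simp add: S_iff)
    have "act D m (single C a b h \<otimes>\<^bsub>R\<^esub> single C c d k) = act D (act D m (single C a b h)) (single C c d k)"
    proof (cases "d = a")
      case True
      then show ?thesis
        using ab cd m mb
        by (simp add: single_mult_single act_single Comp_closed sum_inj_closed_S FMor_closed FMor_Comp)
          (simp add: sum_inj_def)
    next
      case False
      then show ?thesis
        using ab cd m mb
        by (simp add: single_mult_single act_single Comp_closed sum_inj_closed_S FMor_closed act_zero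
            del: one_sum_group)
          (simp add: sum_inj_def FMor_one, auto simp: fun_eq_iff)
    qed
    then show "act D m (single C a b h \<otimes>\<^bsub>R\<^esub> sum_inj (Ob C \<times> Ob C) (\<lambda>(a, b). hom_group C b a) i k)
        = act D (act D m (single C a b h)) (sum_inj (Ob C \<times> Ob C) (\<lambda>(a, b). hom_group C b a) i k)"
      by (simp add: i single_eq_sum_inj)
  qed
  note * = this
  show ?thesis
  proof (rule sum_group_hom_eq[where h = "\<lambda>f. act D m (f \<otimes>\<^bsub>R\<^esub> g)"
        and k = "\<lambda>f. act D (act D m f) g", OF group_ring_summand group_S _ _ _ f])
    show "(\<lambda>f. act D m (f \<otimes>\<^bsub>R\<^esub> g)) \<in> hom (ring_group C) S"
      using Group.hom_compose[OF ring_mult_hom_left[OF g] act_hom_right[OF m]] by (simp add: o_def)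
    show "(\<lambda>f. act D (act D m f) g) \<in> hom (ring_group C) S"
      using Group.hom_compose[OF act_hom_right[OF m] act_hom_left[OF g]] by (simp add: o_def)
    show "act D m (sum_inj (Ob C \<times> Ob C) (\<lambda>(a, b). hom_group C b a) i k \<otimes>\<^bsub>R\<^esub> g)
        = act D (act D m (sum_inj (Ob C \<times> Ob C) (\<lambda>(a, b). hom_group C b a) i k)) g"
      if "i \<in> Ob C \<times> Ob C" "k \<in> carrier (case i of (a, b) \<Rightarrow> hom_group C b a)" for i k
      using that *[of "snd i" "fst i" k] by (auto simp: single_eq_sum_inj hom_group_simps)
  qed
qed

end

context small_linear_category
begin

text \<open>Since row \<open>p\<close> of \<open>f g\<close> is row \<open>p\<close> of \<open>f\<close> acted on by \<open>g\<close>, this is \<open>act_mult\<close> for representable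
  presheaves.\<close>

lemma ring_mult_assoc:
  assumes f: "f \<in> carrier (ring_group C)" and g: "g \<in> carrier (ring_group C)"
    and h: "h \<in> carrier (ring_group C)"
  shows "f \<otimes>\<^bsub>R\<^esub> g \<otimes>\<^bsub>R\<^esub> h = f \<otimes>\<^bsub>R\<^esub> (g \<otimes>\<^bsub>R\<^esub> h)"
proof (rule sum_group_eqI[OF group_ring_summand])
  fix i
  assume "i \<in> Ob C \<times> Ob C"
  then obtain p q where i: "i = (p, q)" "p \<in> Ob C" "q \<in> Ob C" by auto
  interpret P: presheaf C "representable C p"
    using i(2) by (rule presheaf_representable)
  have row: "row C p f \<in> carrier P.S"
    using i(2) f by (rule row_closed)
  have "row C p (f \<otimes>\<^bsub>R\<^esub> g) = act P.D (row C p f) g"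
  proof (rule sum_group_eqI[OF P.group_FOb])
    show "row C p (f \<otimes>\<^bsub>R\<^esub> g) \<in> carrier P.S"
      by (rule row_closed[OF i(2) ring_mult_closed[OF f g]])
    show "act P.D (row C p f) g \<in> carrier P.S"
      by (rule P.act_closed[OF row g])
    show "row C p (f \<otimes>\<^bsub>R\<^esub> g) c = act P.D (row C p f) g c" if "c \<in> Ob C" for c
      using that i(2) f g ring_mult_component[of p c f g] by (simp add: row_def)
  qed
  then show "(f \<otimes>\<^bsub>R\<^esub> g \<otimes>\<^bsub>R\<^esub> h) i = (f \<otimes>\<^bsub>R\<^esub> (g \<otimes>\<^bsub>R\<^esub> h)) i"
    using i f g h by (simp add: ring_mult_component ring_mult_closed P.act_mult row)
qed (use f g h in \<open>auto intro!: ring_mult_closed\<close>)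

lemma nonunital_ring_R: "nonunital_ring R"
proof (intro nonunital_ring.intro nonunital_ring_axioms.intro)
  have "comm_group (ring_group C)"
    by (rule comm_group_sum_group) (auto intro: hom_comm_group)
  then show "abelian_group R"
    unfolding abelian_group_def abelian_group_axioms_def abelian_monoid_def
      add_monoid_category_ring comm_group_def by simp
qed (use hom_mult[OF ring_mult_hom_left] hom_mult[OF ring_mult_hom_right] in
    \<open>simp_all add: carrier_category_ring add_category_ring ring_mult_closed ring_mult_assoc
      del: mult_sum_group\<close>)

end

context presheaf
begin

lemma comm_group_D: "comm_group D"
proof -
  have "comm_group S"
    by (rule comm_group_sum_group) (rule comm_group_FOb)
  then show ?thesis
    using comm_groupE[of S] by (intro comm_groupI) (auto simp del: one_sum_group mult_sum_group)
qed

lemma right_module_D: "right_module R D"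
  by (intro right_module.intro right_module_axioms.intro nonunital_ring_R comm_group_D)
    (simp_all add: carrier_category_ring add_category_ring act_closed act_mult
      hom_mult[OF act_hom_left] hom_mult[OF act_hom_right] del: mult_sum_group)

text \<open>An element of the direct sum is fixed by the sum of the identities over its support.\<close>

lemma unital_module_D: "unital_module R D"
proof -
  interpret D: comm_group D
    by (rule comm_group_D)
  let ?P = "{act D x r |x r. x \<in> carrier D \<and> r \<in> carrier R}"
  have "m \<in> ?P" if m: "m \<in> carrier S" for m
  proof -
    let ?A = "{a \<in> Ob C. m a \<noteq> \<one>\<^bsub>FOb M a\<^esub>}"
    define e where "e = (\<lambda>(p, q) \<in> Ob C \<times> Ob C. if p = q \<and> p \<in> ?A then Ident C p else hzero C q p)"
    have "{p \<in> Ob C \<times> Ob C. e p \<noteq> hzero C (snd p) (fst p)} \<subseteq> (\<lambda>a. (a, a)) ` ?A"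
      by (auto simp: e_def split: if_splits)
    moreover have "finite ?A"
      using m by (simp add: S_iff)
    ultimately have "finite {p \<in> Ob C \<times> Ob C. e p \<noteq> hzero C (snd p) (fst p)}"
      by (meson finite_imageI finite_subset)
    then have e: "e \<in> carrier (ring_group C)"
      by (simp add: ring_group_iff) (simp add: e_def Ident_closed hzero_closed)
    have "act D m e = m"
    proof (rule sum_group_eqI[OF group_FOb act_closed[OF m e] m])
      fix a
      assume a: "a \<in> Ob C"
      interpret comm_group "FOb M a" using a by (rule comm_group_FOb)
      have ma: "m b \<in> carrier (FOb M b)" if "b \<in> Ob C" for b
        using m that by (simp add: S_iff)
      have *: "FMor M b a (e (b, a)) (m b) = (if b = a then m a else \<one>\<^bsub>FOb M a\<^esub>)" if "b \<in> Ob C" for b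
        using a that ma by (auto simp: e_def FMor_Ident FMor_hzero)
      have "gfinprod (FOb M a) (\<lambda>b. FMor M b a (e (b, a)) (m b)) (Ob C) = FMor M a a (e (a, a)) (m a)"
        by (rule gfinprod_singleton) (use a ma * in auto)
      then show "act D m e a = m a"
        using a * by (simp add: act_direct_sum_module)
    qed auto
    then show ?thesis
      using m e by (intro CollectI exI[of _ m] exI[of _ e]) (simp add: carrier_category_ring)
  qed
  then have "carrier D \<subseteq> generate D ?P"
    by (auto intro: generate.incl)
  moreover have "?P \<subseteq> carrier D"
    by (auto simp: carrier_category_ring act_closed)
  ultimately show ?thesis
    unfolding unital_module_def using D.generate_incl by blast
qed

end

section \<open>Transport into the universe\<close>

lemma from_to_universe:
  "\<lbrakk>inj_on (to_universe A :: 'v \<Rightarrow> 'u) A; x \<in> A\<rbrakk> \<Longrightarrow> from_universe A (to_universe A x :: 'u) = x"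
  by (simp add: from_universe_def)

text \<open>A finitely supported family is determined by a finite subset of \<open>Ob C \<times> 'u\<close>, and an infinite
  set has no more finite subsets than elements.\<close>

lemma (in presheaf) inj_to_universe:
  assumes inf: "infinite (UNIV :: 'u set)" and small: "Ob C \<lesssim> (UNIV :: 'u set)"
  shows "inj_on (to_universe (carrier S) :: ('o \<Rightarrow> 'u) \<Rightarrow> 'u) (carrier S)"
proof -
  let ?k = "\<lambda>a. if a \<in> Ob C then \<one>\<^bsub>FOb M a\<^esub> else undefined"
  let ?X = "{f. f ` Ob C \<subseteq> (UNIV :: 'u set) \<and> {a. f a \<noteq> ?k a} \<subseteq> Ob C \<and> finite {a. f a \<noteq> ?k a}}"
  have "carrier S \<subseteq> ?X"
  proof
    fix m
    assume m: "m \<in> carrier S"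
    then have "{a. m a \<noteq> ?k a} = {a \<in> Ob C. m a \<noteq> \<one>\<^bsub>FOb M a\<^esub>}"
      by (auto simp: S_iff extensional_def)
    then show "m \<in> ?X"
      using m by (simp add: S_iff)
  qed
  then have "carrier S \<lesssim> ?X"
    by (rule subset_imp_lepoll)
  also have "?X \<lesssim> Fpow (Ob C \<times> (UNIV :: 'u set))"
    by (rule lepoll_restricted_funspace)
  also have "\<dots> \<lesssim> (UNIV :: 'u set)"
  proof (cases "finite (Ob C \<times> (UNIV :: 'u set))")
    case True
    then have "finite (Fpow (Ob C \<times> (UNIV :: 'u set)))"
      by (simp add: Fpow_def)
    with inf show ?thesis
      by (rule finite_lepoll_infinite)
  next
    case False
    then have "Fpow (Ob C \<times> (UNIV :: 'u set)) \<approx> Ob C \<times> (UNIV :: 'u set)"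
      by (rule eqpoll_Fpow)
    also have "\<dots> \<lesssim> (UNIV :: 'u set) \<times> (UNIV :: 'u set)"
      using small by (rule times_lepoll_mono) simp
    also have "\<dots> \<approx> (UNIV :: 'u set)"
      unfolding eqpoll_iff_card_of_ordIso using inf by (rule card_of_Times_same_infinite)
    finally show ?thesis .
  qed
  finally obtain e :: "('o \<Rightarrow> 'u) \<Rightarrow> 'u" where "inj_on e (carrier S)"
    unfolding lepoll_def by blast
  then show ?thesis
    unfolding to_universe_def by (rule someI[where P = "\<lambda>e. inj_on e (carrier S)"])
qed

text \<open>Injectivity of \<open>e\<close> amounts to the existence of some injection of the carrier into \<open>'u\<close>, as
  \<^const>\<open>to_universe\<close> chooses one if possible.\<close>

locale transportable_module = right_module R N
  for R :: "('r, 'x) ring_scheme" and N :: "('v, 'r) right_module" +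
  fixes e :: "'v \<Rightarrow> 'u"
  assumes e_def: "e = to_universe (carrier N)" and inj: "inj_on e (carrier N)"
begin

abbreviation T :: "('u, 'r) right_module" where "T \<equiv> transport_module N"

lemma from_e: "x \<in> carrier N \<Longrightarrow> from_universe (carrier N) (e x) = x"
  using from_to_universe[OF inj[unfolded e_def]] by (simp add: e_def)

lemma carrier_T: "carrier T = e ` carrier N"
  and one_T: "\<one>\<^bsub>T\<^esub> = e \<one>\<^bsub>N\<^esub>"
  by (simp_all add: transport_module_def Let_def e_def)

lemma mult_T: "\<lbrakk>x \<in> carrier N; y \<in> carrier N\<rbrakk> \<Longrightarrow> e x \<otimes>\<^bsub>T\<^esub> e y = e (x \<otimes>\<^bsub>N\<^esub> y)"
  and act_T: "x \<in> carrier N \<Longrightarrow> act T (e x) r = e (act N x r)"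
  by (simp_all add: transport_module_def Let_def from_e e_def[symmetric])

lemma hom_e: "e \<in> hom N T"
  by (rule homI) (auto simp: carrier_T mult_T)

lemma comm_group_T: "comm_group T"
proof -
  have "comm_group (T\<lparr>carrier := e ` carrier N, one := e \<one>\<^bsub>N\<^esub>\<rparr>)"
    by (rule hom_imp_img_comm_group[OF hom_e])
  then show ?thesis
    by (simp flip: carrier_T one_T)
qed

lemma right_module_T: "right_module R T"
  by (intro right_module.intro right_module_axioms.intro ring.nonunital_ring_axioms comm_group_T)
    (auto simp: carrier_T mult_T act_T act_closed act_add_left act_add_right act_mult)

lemma unital_module_T:
  assumes "unital_module R N"
  shows "unital_module R T"
proof -
  interpret group_hom N T e
    by (intro group_hom.intro group_hom_axioms.intro is_group hom_e comm_group.axioms(2)[OF comm_group_T])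
  let ?P = "{act N x r |x r. x \<in> carrier N \<and> r \<in> carrier R}"
  have "{act T y r |y r. y \<in> carrier T \<and> r \<in> carrier R} = e ` ?P"
  proof (intro equalityI subsetI)
    fix z
    assume "z \<in> e ` ?P"
    then obtain x r where "x \<in> carrier N" "r \<in> carrier R" "z = act T (e x) r"
      by (auto simp: act_T)
    then show "z \<in> {act T y r |y r. y \<in> carrier T \<and> r \<in> carrier R}"
      by (auto simp: carrier_T)
  qed (auto simp: carrier_T act_T intro!: imageI, blast)
  moreover have "generate T (e ` ?P) = e ` generate N ?P"
    by (rule generate_img) (auto simp: act_closed)
  ultimately show ?thesis
    using assms by (simp add: unital_module_def carrier_T)
qed

lemma transport_map_e: "x \<in> carrier N \<Longrightarrow> transport_map N P \<phi> (e x) = to_universe (carrier P) (\<phi> x)"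
  by (simp add: transport_map_def from_e flip: e_def)

lemma transport_map_extensional: "transport_map N P \<phi> \<in> extensional (carrier T)"
  by (simp add: transport_map_def carrier_T e_def)

end

lemma transport_map_hom:
  assumes "transportable_module R N (to_universe (carrier N) :: 'v \<Rightarrow> 'u)"
    and "transportable_module R P (to_universe (carrier P) :: 'v \<Rightarrow> 'u)"
    and \<phi>: "\<phi> \<in> hom N P" "\<And>x r. \<lbrakk>x \<in> carrier N; r \<in> carrier R\<rbrakk> \<Longrightarrow> \<phi> (act N x r) = act P (\<phi> x) r"
  shows "(transport_map N P \<phi> :: 'u \<Rightarrow> 'u)
    \<in> Hom (unital_modules R) (transport_module N) (transport_module P)"
proof -
  interpret N: transportable_module R N "to_universe (carrier N) :: 'v \<Rightarrow> 'u" by fact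
  interpret P: transportable_module R P "to_universe (carrier P) :: 'v \<Rightarrow> 'u" by fact
  have \<phi>_closed: "\<phi> x \<in> carrier P" if "x \<in> carrier N" for x
    using \<phi>(1) that by (rule hom_in_carrier)
  let ?t = "transport_map N P \<phi> :: 'u \<Rightarrow> 'u"
  have "?t \<in> hom N.T P.T"
    using hom_mult[OF \<phi>(1)]
    by (auto intro!: homI
        simp: N.carrier_T N.mult_T N.transport_map_e P.carrier_T P.mult_T \<phi>_closed)
  moreover have "?t (act N.T y r) = act P.T (?t y) r" if "y \<in> carrier N.T" "r \<in> carrier R" for y r
    using that \<phi>(2) by (auto simp: N.carrier_T N.act_T N.act_closed N.transport_map_e P.act_T \<phi>_closed)
  ultimately show ?thesis
    using N.transport_map_extensional by (auto simp: unital_modules_def)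
qed

section \<open>The functor from presheaves to modules\<close>

lemma nat_trans_presheaf_iff:
  assumes "presheaf C M" "presheaf C M'"
  shows "\<tau> \<in> nat_trans (opposite C) Ab M M' \<longleftrightarrow>
    \<tau> \<in> extensional (Ob C) \<and>
    (\<forall>a \<in> Ob C. \<tau> a \<in> hom (FOb M a) (FOb M' a) \<inter> extensional (carrier (FOb M a))) \<and>
    (\<forall>a \<in> Ob C. \<forall>b \<in> Ob C. \<forall>f \<in> Hom C a b. \<forall>x \<in> carrier (FOb M b).
       \<tau> a (FMor M b a f x) = FMor M' b a f (\<tau> b x))"
proof -
  interpret M: presheaf C M by fact
  interpret M': presheaf C M' by fact
  have "compose X f g = compose X h k \<longleftrightarrow> (\<forall>x \<in> X. f (g x) = h (k x))" for X and f g h k :: "'c \<Rightarrow> 'c"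
    by (auto simp: compose_def fun_eq_iff)
  then show ?thesis
    by (auto simp: nat_trans_def opposite_def Ab_def PiE_iff)
qed

definition sum_map :: "('o, 'm) linear_category \<Rightarrow> ('o \<Rightarrow> 'u \<Rightarrow> 'u) \<Rightarrow> ('o \<Rightarrow> 'u) \<Rightarrow> 'o \<Rightarrow> 'u" where
  "sum_map C \<tau> m = (\<lambda>a \<in> Ob C. \<tau> a (m a))"

locale presheaf_map = source: presheaf C M + target: presheaf C M'
  for C :: "('o, 'm) linear_category"
    and M M' :: "('o, 'm, 'u monoid, 'u \<Rightarrow> 'u) cat_functor" +
  fixes \<tau> :: "'o \<Rightarrow> 'u \<Rightarrow> 'u"
  assumes nat_trans: "\<tau> \<in> nat_trans (opposite C) Ab M M'"
begin

lemma component_hom: "a \<in> Ob C \<Longrightarrow> \<tau> a \<in> hom (FOb M a) (FOb M' a)"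
  and component_extensional: "a \<in> Ob C \<Longrightarrow> \<tau> a \<in> extensional (carrier (FOb M a))"
  and natural: "\<lbrakk>a \<in> Ob C; b \<in> Ob C; f \<in> Hom C a b; x \<in> carrier (FOb M b)\<rbrakk>
    \<Longrightarrow> \<tau> a (FMor M b a f x) = FMor M' b a f (\<tau> b x)"
  using nat_trans
  unfolding nat_trans_presheaf_iff[OF source.presheaf_axioms target.presheaf_axioms] by auto

lemma component_closed: "\<lbrakk>a \<in> Ob C; x \<in> carrier (FOb M a)\<rbrakk> \<Longrightarrow> \<tau> a x \<in> carrier (FOb M' a)"
  by (rule hom_in_carrier[OF component_hom])

lemma component_one: "a \<in> Ob C \<Longrightarrow> \<tau> a \<one>\<^bsub>FOb M a\<^esub> = \<one>\<^bsub>FOb M' a\<^esub>"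
  by (rule hom_one[OF component_hom]) (auto simp: source.group_FOb target.group_FOb)

lemma sum_map_closed:
  assumes m: "m \<in> carrier source.S"
  shows "sum_map C \<tau> m \<in> carrier target.S"
proof -
  have "{a \<in> Ob C. sum_map C \<tau> m a \<noteq> \<one>\<^bsub>FOb M' a\<^esub>} \<subseteq> {a \<in> Ob C. m a \<noteq> \<one>\<^bsub>FOb M a\<^esub>}"
    by (auto simp: sum_map_def component_one)
  then have "finite {a \<in> Ob C. sum_map C \<tau> m a \<noteq> \<one>\<^bsub>FOb M' a\<^esub>}"
    using m by (auto simp: source.S_iff intro: finite_subset)
  then show ?thesis
    using m by (simp add: target.S_iff source.S_iff) (simp add: sum_map_def component_closed)
qed

lemma sum_map_hom: "sum_map C \<tau> \<in> hom source.S target.S"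
proof (rule sum_group_homI)
  show "(\<lambda>m. sum_map C \<tau> m a) \<in> hom source.S (FOb M' a)" if "a \<in> Ob C" for a
    using that hom_mult[OF component_hom[OF that]]
    by (auto intro!: homI simp: sum_map_def source.S_iff component_closed)
qed (auto simp: target.group_FOb source.group_S sum_map_closed)

lemma sum_map_sum_inj:
  "a \<in> Ob C \<Longrightarrow> sum_map C \<tau> (sum_inj (Ob C) (FOb M) a x) = sum_inj (Ob C) (FOb M') a (\<tau> a x)"
  by (auto simp: sum_map_def sum_inj_def component_one)

text \<open>By additivity in \<open>f\<close> this reduces to single morphisms, where it is the naturality of \<open>\<tau>\<close>.\<close>

lemma sum_map_act:
  assumes m: "m \<in> carrier source.S" and f: "f \<in> carrier (ring_group C)"
  shows "sum_map C \<tau> (act source.D m f) = act target.D (sum_map C \<tau> m) f"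
proof (rule sum_group_hom_eq[where h = "\<lambda>f. sum_map C \<tau> (act source.D m f)",
      OF source.group_ring_summand target.group_S _ _ _ f])
  show "(\<lambda>f. sum_map C \<tau> (act source.D m f)) \<in> hom (ring_group C) target.S"
    using Group.hom_compose[OF source.act_hom_right[OF m] sum_map_hom] by (simp add: o_def)
  show "act target.D (sum_map C \<tau> m) \<in> hom (ring_group C) target.S"
    by (rule target.act_hom_right[OF sum_map_closed[OF m]])
next
  fix i h
  assume "i \<in> Ob C \<times> Ob C" "h \<in> carrier (case i of (a, b) \<Rightarrow> hom_group C b a)"
  then obtain a b where i: "i = (b, a)" and ab: "a \<in> Ob C" "b \<in> Ob C" "h \<in> Hom C a b"
    by (auto simp: hom_group_simps)
  have "m b \<in> carrier (FOb M b)"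
    using m ab by (simp add: source.S_iff)
  then have "sum_map C \<tau> (act source.D m (single C a b h)) = act target.D (sum_map C \<tau> m) (single C a b h)"
    using ab m
    by (simp add: source.act_single target.act_single sum_map_closed sum_map_sum_inj natural)
      (simp add: sum_map_def)
  then show "sum_map C \<tau> (act source.D m (sum_inj (Ob C \<times> Ob C) (\<lambda>(a, b). hom_group C b a) i h))
      = act target.D (sum_map C \<tau> m) (sum_inj (Ob C \<times> Ob C) (\<lambda>(a, b). hom_group C b a) i h)"
    by (simp add: i single_eq_sum_inj)
qed

end

lemma Ob_functor_category:
  assumes "linear_category C"
  shows "M \<in> Ob (functor_category (opposite C) Ab) \<longleftrightarrow> presheaf C M"
  by (simp add: functor_category_def presheaf_iff_linear_functor[OF assms])

locale presheaf_in_universe = presheaf C M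
  for C :: "('o, 'm) linear_category" and M :: "('o, 'm, 'u monoid, 'u \<Rightarrow> 'u) cat_functor" +
  assumes infinite: "infinite (UNIV :: 'u set)" and small: "Ob C \<lesssim> (UNIV :: 'u set)"
begin

abbreviation embed :: "('o \<Rightarrow> 'u) \<Rightarrow> 'u" where "embed \<equiv> to_universe (carrier S)"

sublocale transported: transportable_module R D embed
  rewrites "carrier D = carrier S"
proof -
  show "transportable_module R D embed"
    using inj_to_universe[OF infinite small]
    by (simp add: transportable_module_def transportable_module_axioms_def right_module_D)
qed simp_all

lemma sum_functor_FOb: "FOb (sum_functor C) M = transport_module D"
  by (simp add: sum_functor_def)

lemma sum_functor_closed: "FOb (sum_functor C) M \<in> Ob (unital_modules R)"
  using transported.right_module_T transported.unital_module_T[OF unital_module_D]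
  by (simp add: unital_modules_def sum_functor_FOb)

end

lemma cat_functor_sum_functor:
  fixes C :: "('o, 'm) linear_category"
  assumes C: "linear_category C"
    and inf: "infinite (UNIV :: 'u set)" and small: "Ob C \<lesssim> (UNIV :: 'u set)"
  shows "cat_functor (functor_category (opposite C) (Ab :: ('u monoid, 'u \<Rightarrow> 'u) linear_category))
    (unital_modules (category_ring C)) (sum_functor C)"
proof (intro cat_functor.intro cat_functor_axioms.intro category_functor_category
    category_unital_modules)
  let ?A = "functor_category (opposite C) (Ab :: ('u monoid, 'u \<Rightarrow> 'u) linear_category)"
  let ?F = "sum_functor C"
  have Ob: "presheaf_in_universe C M" if "M \<in> Ob ?A" for M
    using that inf small
    by (simp add: Ob_functor_category[OF C] presheaf_in_universe_def presheaf_in_universe_axioms_def)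
  have Hom: "presheaf_map C M M' \<tau>" if "M \<in> Ob ?A" "M' \<in> Ob ?A" "\<tau> \<in> Hom ?A M M'" for M M' \<tau>
    using that
    by (simp add: Ob_functor_category[OF C] presheaf_map_def presheaf_map_axioms_def)
      (simp add: functor_category_def)
  have FMor: "FMor ?F M M' \<tau> = transport_map (direct_sum_module C M) (direct_sum_module C M') (sum_map C \<tau>)"
    for M M' :: "('o, 'm, 'u monoid, 'u \<Rightarrow> 'u) cat_functor" and \<tau>
    by (simp add: sum_functor_def sum_map_def[abs_def])
  show "FOb ?F M \<in> Ob (unital_modules (category_ring C))" if "M \<in> Ob ?A" for M
    using presheaf_in_universe.sum_functor_closed[OF Ob[OF that]] .
  show "FMor ?F M M' \<tau> \<in> Hom (unital_modules (category_ring C)) (FOb ?F M) (FOb ?F M')"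
    if M: "M \<in> Ob ?A" "M' \<in> Ob ?A" "\<tau> \<in> Hom ?A M M'" for M M' \<tau>
  proof -
    interpret M: presheaf_in_universe C M using M by (intro Ob)
    interpret M': presheaf_in_universe C M' using M by (intro Ob)
    interpret \<tau>: presheaf_map C M M' \<tau> using M by (intro Hom)
    have "sum_map C \<tau> \<in> hom M.D M'.D"
      using \<tau>.sum_map_hom by (simp add: hom_def)
    then show ?thesis
      unfolding FMor M.sum_functor_FOb M'.sum_functor_FOb
      by (intro transport_map_hom)
        (auto simp: carrier_category_ring \<tau>.sum_map_act
          M.transported.transportable_module_axioms M'.transported.transportable_module_axioms)
  qed
  show "FMor ?F M M (Ident ?A M) = Ident (unital_modules (category_ring C)) (FOb ?F M)"
    if M: "M \<in> Ob ?A" for M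
  proof -
    interpret M: presheaf_in_universe C M using M by (intro Ob)
    show ?thesis
    proof (rule extensionalityI)
      fix y
      assume "y \<in> carrier M.transported.T"
      then obtain m where m: "m \<in> carrier M.S" "y = M.embed m"
        by (auto simp: M.transported.carrier_T)
      have "sum_map C (Ident ?A M) m = m"
        using m(1) by (auto simp: sum_map_def functor_category_def opposite_def Ab_def M.S_iff
            intro!: extensionalityI[of _ "Ob C"])
      then show "FMor ?F M M (Ident ?A M) y = Ident (unital_modules (category_ring C)) (FOb ?F M) y"
        using m by (simp add: FMor M.transported.transport_map_e unital_modules_def
            M.sum_functor_FOb M.transported.carrier_T)
    qed (auto simp: FMor M.transported.transport_map_extensional unital_modules_def M.sum_functor_FOb)
  qed
  show "FMor ?F M M'' (Comp ?A M M' M'' \<tau> \<sigma>)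
      = Comp (unital_modules (category_ring C)) (FOb ?F M) (FOb ?F M') (FOb ?F M'')
        (FMor ?F M' M'' \<tau>) (FMor ?F M M' \<sigma>)"
    if M: "M \<in> Ob ?A" "M' \<in> Ob ?A" "M'' \<in> Ob ?A" "\<sigma> \<in> Hom ?A M M'" "\<tau> \<in> Hom ?A M' M''"
    for M M' M'' \<sigma> \<tau>
  proof -
    interpret M: presheaf_in_universe C M using M by (intro Ob)
    interpret M': presheaf_in_universe C M' using M by (intro Ob)
    interpret \<sigma>: presheaf_map C M M' \<sigma> using M by (intro Hom)
    show ?thesis
    proof (rule extensionalityI)
      fix y
      assume "y \<in> carrier M.transported.T"
      then obtain m where m: "m \<in> carrier M.S" "y = M.embed m"
        by (auto simp: M.transported.carrier_T)
      have "sum_map C (Comp ?A M M' M'' \<tau> \<sigma>) m = sum_map C \<tau> (sum_map C \<sigma> m)"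
        using m(1) by (auto simp: sum_map_def functor_category_def opposite_def Ab_def M.S_iff
            compose_eq intro!: restrict_ext)
      then show "FMor ?F M M'' (Comp ?A M M' M'' \<tau> \<sigma>) y
          = Comp (unital_modules (category_ring C)) (FOb ?F M) (FOb ?F M') (FOb ?F M'')
            (FMor ?F M' M'' \<tau>) (FMor ?F M M' \<sigma>) y"
        using m by (simp add: FMor M.transported.transport_map_e M'.transported.transport_map_e
            unital_modules_def M.sum_functor_FOb M.transported.carrier_T compose_eq \<sigma>.sum_map_closed)
    qed (auto simp: FMor M.transported.transport_map_extensional unital_modules_def M.sum_functor_FOb)
  qed
qed

section \<open>The functor from modules to presheaves\<close>

locale unital_right_module = small_linear_category C + right_module "category_ring C" N
  for C :: "('o, 'm) linear_category" and N :: "('u, 'o \<times> 'o \<Rightarrow> 'm) right_module" +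
  assumes unital: "unital_module (category_ring C) N"
begin

abbreviation idem :: "'o \<Rightarrow> 'o \<times> 'o \<Rightarrow> 'm" where "idem a \<equiv> single C a a (Ident C a)"

lemma act_ring_closed: "\<lbrakk>x \<in> carrier N; r \<in> carrier (ring_group C)\<rbrakk> \<Longrightarrow> act N x r \<in> carrier N"
  by (simp add: act_closed carrier_category_ring)

lemma act_single_closed:
  "\<lbrakk>x \<in> carrier N; a \<in> Ob C; b \<in> Ob C; f \<in> Hom C a b\<rbrakk> \<Longrightarrow> act N x (single C a b f) \<in> carrier N"
  by (simp add: act_ring_closed single_closed)

lemma act_hom_right: "x \<in> carrier N \<Longrightarrow> act N x \<in> hom (ring_group C) N"
  using act_add_right[of x]
  by (auto intro!: homI simp: carrier_category_ring add_category_ring act_ring_closed simp del: mult_sum_group)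

lemma act_hom_left: "r \<in> carrier (ring_group C) \<Longrightarrow> (\<lambda>x. act N x r) \<in> hom N N"
  using act_add_left[of _ _ r]
  by (auto intro!: homI simp: carrier_category_ring act_ring_closed)

lemma act_zero: "x \<in> carrier N \<Longrightarrow> act N x \<zero>\<^bsub>R\<^esub> = \<one>\<^bsub>N\<^esub>"
  unfolding zero_category_ring by (rule hom_one[OF act_hom_right group_ring_group is_group])

lemma one_act: "r \<in> carrier (ring_group C) \<Longrightarrow> act N \<one>\<^bsub>N\<^esub> r = \<one>\<^bsub>N\<^esub>"
  by (rule hom_one[OF act_hom_left is_group is_group])

lemma act_single_single:
  assumes "x \<in> carrier N" "a \<in> Ob C" "b \<in> Ob C" "b' \<in> Ob C" "c \<in> Ob C" "f \<in> Hom C a b" "g \<in> Hom C b' c"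
  shows "act N (act N x (single C b' c g)) (single C a b f)
    = (if b = b' then act N x (single C a c (Comp C a b c g f)) else \<one>\<^bsub>N\<^esub>)"
proof -
  have "act N (act N x (single C b' c g)) (single C a b f)
      = act N x (single C b' c g \<otimes>\<^bsub>R\<^esub> single C a b f)"
    using assms by (simp add: act_mult carrier_category_ring single_closed)
  then show ?thesis
    using assms by (simp add: single_mult_single act_zero)
qed

text \<open>Since \<open>id\<^sub>a\<close> is idempotent, \<open>N \<cdot> id\<^sub>a\<close> consists of its fixed points.\<close>

lemma carrier_component_iff:
  assumes a: "a \<in> Ob C"
  shows "x \<in> carrier (component C N a) \<longleftrightarrow> x \<in> carrier N \<and> act N x (idem a) = x"
proof
  assume "x \<in> carrier (component C N a)"
  then obtain y where "y \<in> carrier N" "x = act N y (idem a)"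
    by (auto simp: component_def)
  then show "x \<in> carrier N \<and> act N x (idem a) = x"
    using a by (simp add: act_single_single act_single_closed Ident_closed Comp_Ident)
next
  assume "x \<in> carrier N \<and> act N x (idem a) = x"
  then show "x \<in> carrier (component C N a)"
    unfolding component_def by (auto intro!: image_eqI[of _ _ x])
qed

lemma component_simps [simp]:
  "mult (component C N a) = mult N"
  "one (component C N a) = one N"
  by (simp_all add: component_def)

lemma act_single_component:
  assumes "x \<in> carrier N" "a \<in> Ob C" "b \<in> Ob C" "f \<in> Hom C a b"
  shows "act N x (single C a b f) \<in> carrier (component C N a)"
  using assms
  by (simp add: carrier_component_iff act_single_single act_single_closed Ident_closed Comp_Ident)

text \<open>Here \<open>x = x \<cdot> id\<^bsub>b'\<^esub>\<close>, and the product of \<open>id\<^bsub>b'\<^esub>\<close> and \<open>f\<close> is zero in the ring.\<close>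

lemma component_act_single:
  assumes "a \<in> Ob C" "b \<in> Ob C" "b' \<in> Ob C" "f \<in> Hom C a b" "x \<in> carrier (component C N b')" "b' \<noteq> b"
  shows "act N x (single C a b f) = \<one>\<^bsub>N\<^esub>"
  using act_single_single[of x a b b' b' f "Ident C b'"] assms
  by (auto simp: carrier_component_iff Ident_closed)

text \<open>The component is the image of the endomorphism \<open>x \<mapsto> x \<cdot> id\<^sub>a\<close> of \<open>N\<close>.\<close>

lemma comm_group_component:
  assumes a: "a \<in> Ob C"
  shows "comm_group (component C N a)"
proof -
  let ?h = "\<lambda>x. act N x (idem a)"
  have h: "?h \<in> hom N N"
    using a by (intro act_hom_left single_closed Ident_closed)
  have "comm_group (N\<lparr>carrier := ?h ` carrier N, one := ?h \<one>\<^bsub>N\<^esub>\<rparr>)"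
    by (rule hom_imp_img_comm_group[OF h])
  moreover have "?h \<one>\<^bsub>N\<^esub> = \<one>\<^bsub>N\<^esub>"
    using a by (intro one_act single_closed Ident_closed)
  ultimately show ?thesis
    using comm_groupE[of "N\<lparr>carrier := ?h ` carrier N, one := \<one>\<^bsub>N\<^esub>\<rparr>"]
    by (intro comm_groupI) (simp_all add: component_def)
qed

lemma single_hadd:
  assumes "a \<in> Ob C" "b \<in> Ob C"
  shows "single C a b (hadd C a b f g) = single C a b f \<oplus>\<^bsub>R\<^esub> single C a b g"
  using sum_inj_mult[of "Ob C \<times> Ob C" "\<lambda>(a, b). hom_group C b a" "(b, a)" f g] group_ring_summand
  by (simp add: single_eq_sum_inj add_category_ring hom_group_simps)

lemma module_functor_simps [simp]:
  "FOb (module_functor C N) = component C N"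
  "FMor (module_functor C N) b a f = (\<lambda>x \<in> carrier (component C N b). act N x (single C a b f))"
  by (simp_all add: module_functor_def)

lemma presheaf_module_functor: "presheaf C (module_functor C N)"
proof (intro presheaf.intro presheaf_axioms.intro linear_category_axioms)
  show "FMor (module_functor C N) b a f \<in> hom (FOb (module_functor C N) b) (FOb (module_functor C N) a)"
    if ab: "a \<in> Ob C" "b \<in> Ob C" "f \<in> Hom C a b" for a b f
  proof (rule homI)
    fix x y
    assume x: "x \<in> carrier (FOb (module_functor C N) b)" and y: "y \<in> carrier (FOb (module_functor C N) b)"
    show "FMor (module_functor C N) b a f x \<in> carrier (FOb (module_functor C N) a)"
      using ab x act_single_component[of x a b f] by (simp add: carrier_component_iff)
    have "x \<otimes>\<^bsub>N\<^esub> y \<in> carrier (component C N b)"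
      using comm_groupE(1)[OF comm_group_component[OF ab(2)]] x y by simp
    then show "FMor (module_functor C N) b a f (x \<otimes>\<^bsub>FOb (module_functor C N) b\<^esub> y)
        = FMor (module_functor C N) b a f x \<otimes>\<^bsub>FOb (module_functor C N) a\<^esub> FMor (module_functor C N) b a f y"
      using ab x y hom_mult[OF act_hom_left[OF single_closed[OF ab]]] by (simp add: carrier_component_iff)
  qed
next
  fix a b c f g x
  assume *: "a \<in> Ob C" "b \<in> Ob C" "c \<in> Ob C" "f \<in> Hom C a b" "g \<in> Hom C b c"
    "x \<in> carrier (FOb (module_functor C N) c)"
  then have "x \<in> carrier N"
    by (simp add: carrier_component_iff)
  then show "FMor (module_functor C N) c a (Comp C a b c g f) x
      = FMor (module_functor C N) b a f (FMor (module_functor C N) c b g x)"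
    using * by (simp add: act_single_component act_single_single)
next
  fix a b f g x
  assume *: "a \<in> Ob C" "b \<in> Ob C" "f \<in> Hom C a b" "g \<in> Hom C a b"
    "x \<in> carrier (FOb (module_functor C N) b)"
  then have "x \<in> carrier N"
    by (simp add: carrier_component_iff)
  then show "FMor (module_functor C N) b a (hadd C a b f g) x
      = FMor (module_functor C N) b a f x \<otimes>\<^bsub>FOb (module_functor C N) a\<^esub> FMor (module_functor C N) b a g x"
    using * by (simp add: single_hadd act_add_right single_closed carrier_category_ring)
qed (auto simp: comm_group_component carrier_component_iff)

sublocale presheaf: presheaf C "module_functor C N"
  by (rule presheaf_module_functor)

text \<open>The counit at \<open>N\<close>, before its domain is moved into the universe.\<close>

definition counit :: "('o \<Rightarrow> 'u) \<Rightarrow> 'u" where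
  "counit m = gfinprod N m (Ob C)"

lemma counit_hom: "counit \<in> hom presheaf.S N"
proof -
  have "(\<lambda>m. gfinprod N (\<lambda>a. m a) (Ob C)) \<in> hom presheaf.S N"
    by (rule hom_group_sum)
      (auto intro!: homI simp: presheaf.group_FOb[simplified] carrier_component_iff)
  then show ?thesis
    by (simp add: counit_def[abs_def])
qed

lemma counit_sum_inj:
  assumes "a \<in> Ob C" "x \<in> carrier (component C N a)"
  shows "counit (sum_inj (Ob C) (component C N) a x) = x"
proof -
  have "counit (sum_inj (Ob C) (component C N) a x) = sum_inj (Ob C) (component C N) a x a"
    unfolding counit_def
    by (rule gfinprod_singleton) (use assms in \<open>auto simp: sum_inj_def carrier_component_iff\<close>)
  then show ?thesis
    using assms by (simp add: sum_inj_def)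
qed

lemma counit_closed: "m \<in> carrier presheaf.S \<Longrightarrow> counit m \<in> carrier N"
  by (rule hom_in_carrier[OF counit_hom])

text \<open>Both sides are biadditive in \<open>m\<close> and \<open>r\<close>. For \<open>m\<close> a single summand \<open>x \<in> N \<cdot> id\<^sub>c\<close> and \<open>r\<close> a
  single morphism \<open>h : a \<rightarrow> b\<close>, both are \<open>x \<cdot> h\<close> if \<open>b = c\<close> and vanish otherwise.\<close>

lemma counit_act:
  assumes m: "m \<in> carrier presheaf.S" and r: "r \<in> carrier (ring_group C)"
  shows "counit (act presheaf.D m r) = act N (counit m) r"
proof (rule sum_group_hom_eq[where h = "\<lambda>r. counit (act presheaf.D m r)",
      OF group_ring_summand is_group _ _ _ r])
  show "(\<lambda>r. counit (act presheaf.D m r)) \<in> hom (ring_group C) N"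
    using Group.hom_compose[OF presheaf.act_hom_right[OF m] counit_hom] by (simp add: o_def)
  show "act N (counit m) \<in> hom (ring_group C) N"
    by (rule act_hom_right[OF counit_closed[OF m]])
next
  fix i h
  assume "i \<in> Ob C \<times> Ob C" "h \<in> carrier (case i of (a, b) \<Rightarrow> hom_group C b a)"
  then obtain a b where i: "i = (b, a)" and ab: "a \<in> Ob C" "b \<in> Ob C" "h \<in> Hom C a b"
    by (auto simp: hom_group_simps)
  have h: "single C a b h \<in> carrier (ring_group C)"
    using ab by (rule single_closed)
  have "counit (act presheaf.D m (single C a b h)) = act N (counit m) (single C a b h)"
  proof (rule sum_group_hom_eq[where h = "\<lambda>m. counit (act presheaf.D m (single C a b h))"
        and k = "\<lambda>m. act N (counit m) (single C a b h)", OF presheaf.group_FOb is_group _ _ _ m])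
    show "(\<lambda>m. counit (act presheaf.D m (single C a b h))) \<in> hom presheaf.S N"
      using Group.hom_compose[OF presheaf.act_hom_left[OF h] counit_hom] by (simp add: o_def)
    show "(\<lambda>m. act N (counit m) (single C a b h)) \<in> hom presheaf.S N"
      using Group.hom_compose[OF counit_hom act_hom_left[OF h]] by (simp add: o_def)
  next
    fix c x
    assume c: "c \<in> Ob C" and x: "x \<in> carrier (FOb (module_functor C N) c)"
    let ?x = "sum_inj (Ob C) (FOb (module_functor C N)) c x"
    have *: "act presheaf.D ?x (single C a b h)
        = sum_inj (Ob C) (FOb (module_functor C N)) a (FMor (module_functor C N) b a h (?x b))"
      using ab c x by (intro presheaf.act_single presheaf.sum_inj_closed_S)
    have xb: "?x b \<in> carrier (component C N b)"
      using presheaf.S_component[OF presheaf.sum_inj_closed_S[OF c x] ab(2)] by simp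
    then have "act N (?x b) (single C a b h) \<in> carrier (component C N a)"
      using ab by (intro act_single_component) (auto simp: carrier_component_iff)
    then have "counit (act presheaf.D ?x (single C a b h)) = act N (?x b) (single C a b h)"
      unfolding * using ab xb by (simp add: counit_sum_inj)
    also have "\<dots> = act N x (single C a b h)"
      using ab c x by (cases "c = b") (simp_all add: sum_inj_def component_act_single one_act h)
    finally show "counit (act presheaf.D ?x (single C a b h)) = act N (counit ?x) (single C a b h)"
      using c x by (simp add: counit_sum_inj)
  qed
  then show "counit (act presheaf.D m (sum_inj (Ob C \<times> Ob C) (\<lambda>(a, b). hom_group C b a) i h))
      = act N (counit m) (sum_inj (Ob C \<times> Ob C) (\<lambda>(a, b). hom_group C b a) i h)"
    by (simp add: i single_eq_sum_inj)
qed

text \<open>By linearity the multiplication by \<open>id\<^sub>a\<close> can be done before the summation, and it leaves only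
  the entry at \<open>a\<close>.\<close>

lemma counit_component:
  assumes m: "m \<in> carrier presheaf.S" and a: "a \<in> Ob C"
  shows "act N (counit m) (idem a) = m a"
proof -
  have ma: "m a \<in> carrier (component C N a)"
    using presheaf.S_component[OF m a] by simp
  have "act N (counit m) (idem a) = counit (act presheaf.D m (idem a))"
    using m a by (simp add: counit_act single_closed Ident_closed)
  also have "\<dots> = counit (sum_inj (Ob C) (component C N) a (m a))"
    using m a ma by (simp add: presheaf.act_single Ident_closed carrier_component_iff)
  also have "\<dots> = m a"
    using a ma by (rule counit_sum_inj)
  finally show ?thesis .
qed

text \<open>Injectivity holds since the components of \<open>m\<close> can be recovered from its image. The image is a
  subgroup that contains \<open>x \<cdot> h \<in> N \<cdot> id\<^sub>a\<close> for every single morphism \<open>h : a \<rightarrow> b\<close>, hence all of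
  \<open>N \<cdot> \<A>(C)\<close>. This is where unitality of \<open>N\<close> is used.\<close>

lemma counit_bij: "bij_betw counit (carrier presheaf.S) (carrier N)"
  unfolding bij_betw_def
proof
  show "inj_on counit (carrier presheaf.S)"
  proof (rule inj_onI)
    fix m m'
    assume m: "m \<in> carrier presheaf.S" "m' \<in> carrier presheaf.S" and "counit m = counit m'"
    then show "m = m'"
      using counit_component by (intro sum_group_eqI[OF presheaf.group_FOb m]) (auto, metis)
  qed
  interpret ghom: group_hom presheaf.S N counit
    by (intro group_hom.intro group_hom_axioms.intro presheaf.group_S is_group counit_hom)
  have "act N x r \<in> counit ` carrier presheaf.S"
    if x: "x \<in> carrier N" and r: "r \<in> carrier (ring_group C)" for x r
    using r
  proof (induction r rule: sum_group_induct)
    case one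
    have "act N x \<one>\<^bsub>ring_group C\<^esub> = counit \<one>\<^bsub>presheaf.S\<^esub>"
      using hom_one[OF act_hom_right[OF x] group_ring_group is_group] ghom.hom_one by (rule trans_sym)
    then show ?case
      using presheaf.group_S by (auto intro: group.is_monoid monoid.one_closed simp del: one_sum_group)
  next
    case (sum_inj i h)
    then obtain a b where i: "i = (b, a)" and ab: "a \<in> Ob C" "b \<in> Ob C" "h \<in> Hom C a b"
      by (auto simp: hom_group_simps)
    have c: "act N x (single C a b h) \<in> carrier (component C N a)"
      using x ab by (rule act_single_component)
    then have "act N x (single C a b h) = counit (sum_inj (Ob C) (component C N) a (act N x (single C a b h)))"
      using ab by (simp add: counit_sum_inj)
    then show ?case
      using presheaf.sum_inj_closed_S[of a "act N x (single C a b h)"] c ab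
      by (simp add: i flip: single_eq_sum_inj)
  next
    case (mult r s)
    then show ?case
      using hom_mult[OF act_hom_right[OF x]] ghom.img_is_subgroup by (simp add: subgroup.m_closed del: mult_sum_group)
  qed (rule group_ring_summand)
  then have "{act N x r |x r. x \<in> carrier N \<and> r \<in> carrier R} \<subseteq> counit ` carrier presheaf.S"
    by (auto simp: carrier_category_ring)
  then have "generate N {act N x r |x r. x \<in> carrier N \<and> r \<in> carrier R} \<subseteq> counit ` carrier presheaf.S"
    by (rule generate_subgroup_incl) (rule ghom.img_is_subgroup)
  then show "counit ` carrier presheaf.S = carrier N"
    using unital counit_closed unfolding unital_module_def by auto
qed

end

lemma Ob_unital_modules:
  assumes "linear_category C"
  shows "N \<in> Ob (unital_modules (category_ring C)) \<longleftrightarrow> unital_right_module C N"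
  using assms by (simp add: unital_modules_def unital_right_module_def small_linear_category_def
      unital_right_module_axioms_def)

locale module_map = source: unital_right_module C N + target: unital_right_module C P
  for C :: "('o, 'm) linear_category" and N P :: "('u, 'o \<times> 'o \<Rightarrow> 'm) right_module" +
  fixes \<phi> :: "'u \<Rightarrow> 'u"
  assumes module_hom: "\<phi> \<in> Hom (unital_modules (category_ring C)) N P"
begin

lemma hom: "\<phi> \<in> hom N P"
  and map_act: "\<lbrakk>x \<in> carrier N; r \<in> carrier (ring_group C)\<rbrakk> \<Longrightarrow> \<phi> (act N x r) = act P (\<phi> x) r"
  using module_hom by (auto simp: unital_modules_def carrier_category_ring)

lemma map_closed: "x \<in> carrier N \<Longrightarrow> \<phi> x \<in> carrier P"
  by (rule hom_in_carrier[OF hom])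

lemma map_component:
  "\<lbrakk>a \<in> Ob C; x \<in> carrier (component C N a)\<rbrakk> \<Longrightarrow> \<phi> x \<in> carrier (component C P a)"
  using map_act[of x "single C a a (Ident C a)"]
  by (simp add: source.carrier_component_iff target.carrier_component_iff map_closed
      source.single_closed source.Ident_closed)

definition components :: "'o \<Rightarrow> 'u \<Rightarrow> 'u" where
  "components = (\<lambda>a \<in> Ob C. restrict \<phi> (carrier (component C N a)))"

lemma components_nat_trans:
  "components \<in> nat_trans (opposite C) Ab (module_functor C N) (module_functor C P)"
  unfolding nat_trans_presheaf_iff[OF source.presheaf_module_functor target.presheaf_module_functor]
proof (intro conjI ballI)
  show "components a \<in> hom (FOb (module_functor C N) a) (FOb (module_functor C P) a) \<inter>
      extensional (carrier (FOb (module_functor C N) a))" if a: "a \<in> Ob C" for a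
  proof -
    have "x \<otimes>\<^bsub>N\<^esub> y \<in> carrier (component C N a)"
      if "x \<in> carrier (component C N a)" "y \<in> carrier (component C N a)" for x y
      using comm_groupE(1)[OF source.comm_group_component[OF a] that] by simp
    then show ?thesis
      using a hom_mult[OF hom]
      by (auto intro!: homI simp: components_def map_component source.carrier_component_iff)
  qed
  show "components a (FMor (module_functor C N) b a f x)
      = FMor (module_functor C P) b a f (components b x)"
    if "a \<in> Ob C" "b \<in> Ob C" "f \<in> Hom C a b" "x \<in> carrier (FOb (module_functor C N) b)" for a b f x
  proof -
    have "x \<in> carrier N"
      using that by (simp add: source.carrier_component_iff)
    then show ?thesis
      using that by (simp add: components_def source.act_single_component map_act map_component
          source.single_closed)
  qed
qed (simp add: components_def)

text \<open>Both sides are additive in \<open>m\<close>, and on the summand at \<open>a\<close> both are \<open>\<phi>\<close>.\<close>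

lemma counit_natural:
  assumes m: "m \<in> carrier source.presheaf.S"
  shows "target.counit (sum_map C components m) = \<phi> (source.counit m)"
proof -
  interpret c: presheaf_map C "module_functor C N" "module_functor C P" components
    by (intro presheaf_map.intro presheaf_map_axioms.intro source.presheaf_module_functor
        target.presheaf_module_functor components_nat_trans)
  show ?thesis
  proof (rule sum_group_hom_eq[where h = "\<lambda>m. target.counit (sum_map C components m)"
        and k = "\<lambda>m. \<phi> (source.counit m)", OF source.presheaf.group_FOb target.is_group _ _ _ m])
    show "(\<lambda>m. target.counit (sum_map C components m)) \<in> hom source.presheaf.S P"
      using Group.hom_compose[OF c.sum_map_hom target.counit_hom] by (simp add: o_def)
    show "(\<lambda>m. \<phi> (source.counit m)) \<in> hom source.presheaf.S P"
      using Group.hom_compose[OF source.counit_hom hom] by (simp add: o_def)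
  next
    fix a x
    assume "a \<in> Ob C" "x \<in> carrier (FOb (module_functor C N) a)"
    then show "target.counit (sum_map C components (sum_inj (Ob C) (FOb (module_functor C N)) a x))
        = \<phi> (source.counit (sum_inj (Ob C) (FOb (module_functor C N)) a x))"
      by (simp only: c.sum_map_sum_inj)
        (simp add: source.counit_sum_inj target.counit_sum_inj map_component components_def)
  qed
qed

end

lemma cat_functor_component_functor:
  fixes C :: "('o, 'm) linear_category"
  assumes C: "linear_category C"
  shows "cat_functor (unital_modules (category_ring C))
    (functor_category (opposite C) (Ab :: ('u monoid, 'u \<Rightarrow> 'u) linear_category)) (component_functor C)"
proof (intro cat_functor.intro cat_functor_axioms.intro category_functor_category
    category_unital_modules)
  let ?A = "functor_category (opposite C) (Ab :: ('u monoid, 'u \<Rightarrow> 'u) linear_category)"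
  let ?B = "unital_modules (category_ring C) :: (('u, 'o \<times> 'o \<Rightarrow> 'm) right_module, 'u \<Rightarrow> 'u) category"
  let ?G = "component_functor C"
  have Ob: "unital_right_module C N" if "N \<in> Ob ?B" for N
    using that by (simp add: Ob_unital_modules[OF C])
  have Hom: "module_map C N P \<phi>" if "N \<in> Ob ?B" "P \<in> Ob ?B" "\<phi> \<in> Hom ?B N P" for N P \<phi>
    using that by (simp add: Ob_unital_modules[OF C] module_map_def module_map_axioms_def)
  show "FOb ?G N \<in> Ob ?A" if "N \<in> Ob ?B" for N
    using unital_right_module.presheaf_module_functor[OF Ob[OF that]]
    by (simp add: Ob_functor_category[OF C] component_functor_def)
  show "FMor ?G N P \<phi> \<in> Hom ?A (FOb ?G N) (FOb ?G P)"
    if "N \<in> Ob ?B" "P \<in> Ob ?B" "\<phi> \<in> Hom ?B N P" for N P \<phi>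
    using module_map.components_nat_trans[OF Hom[OF that]]
    unfolding module_map.components_def[OF Hom[OF that]]
    by (simp add: component_functor_def functor_category_def)
  show "FMor ?G N N (Ident ?B N) = Ident ?A (FOb ?G N)" if "N \<in> Ob ?B" for N
  proof -
    interpret unital_right_module C N using that by (rule Ob)
    show ?thesis
      by (auto simp: component_functor_def functor_category_def unital_modules_def opposite_def Ab_def
          carrier_component_iff intro!: restrict_ext)
  qed
  show "FMor ?G N Q (Comp ?B N P Q \<psi> \<phi>)
      = Comp ?A (FOb ?G N) (FOb ?G P) (FOb ?G Q) (FMor ?G P Q \<psi>) (FMor ?G N P \<phi>)"
    if "N \<in> Ob ?B" "P \<in> Ob ?B" "Q \<in> Ob ?B" "\<phi> \<in> Hom ?B N P" "\<psi> \<in> Hom ?B P Q" for N P Q \<phi> \<psi>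
  proof -
    interpret module_map C N P \<phi> using that by (intro Hom)
    show ?thesis
      by (auto simp: component_functor_def functor_category_def unital_modules_def opposite_def Ab_def
          source.carrier_component_iff compose_def map_component intro!: restrict_ext)
  qed
qed

section \<open>The two natural isomorphisms\<close>

context presheaf_in_universe
begin

lemma unital_right_module_T: "unital_right_module C transported.T"
  using sum_functor_closed by (simp add: Ob_unital_modules[OF linear_category_axioms] sum_functor_FOb)

definition unit :: "'o \<Rightarrow> 'u \<Rightarrow> 'u" where
  "unit = (\<lambda>a \<in> Ob C. \<lambda>x \<in> carrier (FOb M a). embed (sum_inj (Ob C) (FOb M) a x))"

text \<open>Multiplication by \<open>id\<^sub>a\<close> projects the direct sum onto its summand at \<open>a\<close>.\<close>

lemma carrier_component_T:
  assumes a: "a \<in> Ob C"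
  shows "carrier (component C transported.T a)
    = (\<lambda>x. embed (sum_inj (Ob C) (FOb M) a x)) ` carrier (FOb M a)" (is "?X = ?f ` ?Y")
proof -
  have act: "act transported.T (embed m) (single C a a (Ident C a)) = ?f (m a)" if "m \<in> carrier S" for m
    using that a by (simp add: transported.act_T act_single Ident_closed FMor_Ident S_component)
  show ?thesis
  proof (intro equalityI subsetI)
    fix y
    assume "y \<in> ?X"
    then show "y \<in> ?f ` ?Y"
      using a by (auto simp: component_def transported.carrier_T act S_component)
  next
    fix y
    assume "y \<in> ?f ` ?Y"
    then obtain x where x: "x \<in> ?Y" "y = ?f x" by auto
    let ?m = "sum_inj (Ob C) (FOb M) a x"
    have m: "?m \<in> carrier S"
      using a x by (intro sum_inj_closed_S)
    have "y = act transported.T (embed ?m) (single C a a (Ident C a))"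
      using a x by (subst act[OF m]) (simp add: sum_inj_def)
    then show "y \<in> ?X"
      using m by (auto simp: component_def transported.carrier_T)
  qed
qed

lemma unit_bij:
  assumes a: "a \<in> Ob C"
  shows "bij_betw (unit a) (carrier (FOb M a)) (carrier (component C transported.T a))"
proof -
  have "inj_on (unit a) (carrier (FOb M a))"
  proof (rule inj_onI)
    fix x y
    assume x: "x \<in> carrier (FOb M a)" and y: "y \<in> carrier (FOb M a)" and eq: "unit a x = unit a y"
    have "sum_inj (Ob C) (FOb M) a x = sum_inj (Ob C) (FOb M) a y"
      using eq a x y inj_onD[OF transported.inj] by (simp add: unit_def sum_inj_closed_S)
    then have "sum_inj (Ob C) (FOb M) a x a = sum_inj (Ob C) (FOb M) a y a"
      by simp
    then show "x = y"
      using a by (simp add: sum_inj_def)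
  qed
  then show ?thesis
    unfolding bij_betw_def carrier_component_T[OF a] using a by (auto simp: unit_def)
qed

lemma unit_nat_trans: "unit \<in> nat_trans (opposite C) Ab M (module_functor C transported.T)"
proof -
  interpret T: unital_right_module C transported.T
    by (rule unital_right_module_T)
  show ?thesis
    unfolding nat_trans_presheaf_iff[OF presheaf_axioms T.presheaf_module_functor]
  proof (intro conjI ballI)
    show "unit a \<in> hom (FOb M a) (FOb (module_functor C transported.T) a) \<inter>
        extensional (carrier (FOb M a))" if a: "a \<in> Ob C" for a
    proof -
      have "x \<otimes>\<^bsub>FOb M a\<^esub> y \<in> carrier (FOb M a)"
        if "x \<in> carrier (FOb M a)" "y \<in> carrier (FOb M a)" for x y
        using comm_groupE(1)[OF comm_group_FOb[OF a] that] .
      then show ?thesis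
        using a bij_betwE[OF unit_bij[OF a]]
        by (auto intro!: homI simp: unit_def sum_inj_mult[of "Ob C" "FOb M", OF group_FOb] transported.mult_T
            sum_inj_closed_S simp del: mult_sum_group)
    qed
    show "unit a (FMor M b a f x)
        = FMor (module_functor C transported.T) b a f (unit b x)"
      if ab: "a \<in> Ob C" "b \<in> Ob C" "f \<in> Hom C a b" and x: "x \<in> carrier (FOb M b)" for a b f x
    proof -
      have "unit b x \<in> carrier (component C transported.T b)"
        using bij_betwE[OF unit_bij[OF ab(2)]] x by blast
      then show ?thesis
        using ab x by (simp add: unit_def FMor_closed transported.act_T act_single sum_inj_closed_S)
          (simp add: sum_inj_def)
    qed
  qed (simp add: unit_def)
qed

end

locale module_in_universe = unital_right_module C N
  for C :: "('o, 'm) linear_category" and N :: "('u, 'o \<times> 'o \<Rightarrow> 'm) right_module" +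
  assumes infinite: "infinite (UNIV :: 'u set)" and small: "Ob C \<lesssim> (UNIV :: 'u set)"
begin

sublocale dsum: presheaf_in_universe C "module_functor C N"
  by unfold_locales (rule infinite small)+

definition counit_map :: "'u \<Rightarrow> 'u" where
  "counit_map = (\<lambda>y \<in> carrier dsum.transported.T. counit (from_universe (carrier presheaf.S) y))"

lemma counit_map_embed:
  "m \<in> carrier (sum_group (Ob C) (component C N))
    \<Longrightarrow> counit_map (to_universe (carrier (sum_group (Ob C) (component C N))) m) = counit m"
  using dsum.transported.from_e by (simp add: counit_map_def dsum.transported.carrier_T)

lemma counit_map_bij: "bij_betw counit_map (carrier dsum.transported.T) (carrier N)"
proof -
  have "bij_betw dsum.embed (carrier presheaf.S) (carrier dsum.transported.T)"
    using dsum.transported.inj by (simp add: bij_betw_def dsum.transported.carrier_T)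
  moreover have "bij_betw (counit_map \<circ> dsum.embed) (carrier presheaf.S) (carrier N)"
    using counit_bij by (rule bij_betw_cong[THEN iffD1, rotated]) (simp add: counit_map_embed)
  ultimately show ?thesis
    by (simp add: bij_betw_comp_iff)
qed

lemma counit_map_hom: "counit_map \<in> Hom (unital_modules R) dsum.transported.T N"
proof -
  have "counit_map \<in> hom dsum.transported.T N"
  proof (rule homI)
    fix y z
    assume "y \<in> carrier dsum.transported.T" "z \<in> carrier dsum.transported.T"
    then obtain m n where m: "m \<in> carrier presheaf.S" "y = dsum.embed m"
      and n: "n \<in> carrier presheaf.S" "z = dsum.embed n"
      by (auto simp: dsum.transported.carrier_T)
    show "counit_map y \<in> carrier N"
      using m by (simp add: counit_map_embed counit_closed)
    have "m \<otimes>\<^bsub>presheaf.S\<^esub> n \<in> carrier presheaf.S"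
      using m n presheaf.group_S by (simp add: group.is_monoid monoid.m_closed del: mult_sum_group)
    then show "counit_map (y \<otimes>\<^bsub>dsum.transported.T\<^esub> z) = counit_map y \<otimes>\<^bsub>N\<^esub> counit_map z"
      using m n hom_mult[OF counit_hom] dsum.transported.mult_T[of m n]
      by (simp add: counit_map_embed del: mult_sum_group)
  qed
  moreover have "counit_map (act dsum.transported.T y r) = act N (counit_map y) r"
    if y: "y \<in> carrier dsum.transported.T" and r: "r \<in> carrier (ring_group C)" for y r
  proof -
    obtain m where m: "m \<in> carrier presheaf.S" "y = dsum.embed m"
      using y by (auto simp: dsum.transported.carrier_T)
    have "act dsum.transported.T y r = dsum.embed (act presheaf.D m r)"
      unfolding m(2) by (rule dsum.transported.act_T[OF m(1)])
    then show ?thesis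
      using m(1) presheaf.act_closed[OF m(1) r] counit_act[OF m(1) r]
      unfolding m(2) by (simp add: counit_map_embed)
  qed
  ultimately show ?thesis
    by (simp add: unital_modules_def carrier_category_ring) (simp add: counit_map_def)
qed

end

theorem proposition3p4:
  fixes C :: "('o, 'm) linear_category"
  assumes "linear_category C"
    and "infinite (UNIV :: 'u set)"
    and "Ob C \<lesssim> (UNIV :: 'u set)"
  shows "mutually_quasi_inverse
    (functor_category (opposite C) (Ab :: ('u monoid, 'u \<Rightarrow> 'u) linear_category))
    (unital_modules (category_ring C))
    (sum_functor C)
    (component_functor C)"
proof -
  note C = assms(1)
  let ?A = "functor_category (opposite C) (Ab :: ('u monoid, 'u \<Rightarrow> 'u) linear_category)"
  let ?B = "unital_modules (category_ring C) :: (('u, 'o \<times> 'o \<Rightarrow> 'm) right_module, 'u \<Rightarrow> 'u) category"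
  let ?F = "sum_functor C :: (('o, 'm, 'u monoid, 'u \<Rightarrow> 'u) cat_functor, 'o \<Rightarrow> 'u \<Rightarrow> 'u,
          ('u, 'o \<times> 'o \<Rightarrow> 'm) right_module, 'u \<Rightarrow> 'u) cat_functor"
  let ?G = "component_functor C"
  have F: "cat_functor ?A ?B ?F"
    using assms by (rule cat_functor_sum_functor)
  have G: "cat_functor ?B ?A ?G"
    using C by (rule cat_functor_component_functor)
  have Ob_A: "presheaf_in_universe C M" if "M \<in> Ob ?A" for M
    using that assms
    by (simp add: Ob_functor_category presheaf_in_universe_def presheaf_in_universe_axioms_def)
  have Ob_B: "module_in_universe C N" if "N \<in> Ob ?B" for N
    using that assms
    by (simp add: Ob_unital_modules module_in_universe_def module_in_universe_axioms_def)
  have G_Ob: "FOb ?G N = module_functor C N"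
    and G_Mor: "FMor ?G N P \<phi> = (\<lambda>a \<in> Ob C. restrict \<phi> (carrier (component C N a)))"
    for N P :: "('u, 'o \<times> 'o \<Rightarrow> 'm) right_module" and \<phi>
    by (simp_all add: component_functor_def)
  have F_Ob: "FOb ?F M = transport_module (direct_sum_module C M)"
    and F_Mor: "FMor ?F M M' \<tau> = transport_map (direct_sum_module C M) (direct_sum_module C M') (sum_map C \<tau>)"
    for M M' :: "('o, 'm, 'u monoid, 'u \<Rightarrow> 'u) cat_functor" and \<tau>
    by (simp_all add: sum_functor_def sum_map_def[abs_def])

  have "naturally_isomorphic ?A ?A id_functor (comp_functor ?G ?F)"
  proof -
    let ?\<eta> = "\<lambda>M \<in> Ob ?A. presheaf_in_universe.unit C M"
    let ?GF = "\<lambda>M. module_functor C (transport_module (direct_sum_module C M)) :: ('o, 'm, 'u monoid, 'u \<Rightarrow> 'u) cat_functor"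
    have GF: "FOb (comp_functor ?G ?F) M = ?GF M" for M
      by (simp add: comp_functor_def G_Ob F_Ob)
    have closed: "presheaf_in_universe.unit C M \<in> nat_trans (opposite C) Ab M (?GF M)"
      if "M \<in> Ob ?A" for M
      by (rule presheaf_in_universe.unit_nat_trans[OF Ob_A[OF that]])
    have "?\<eta> \<in> nat_trans ?A ?A id_functor (comp_functor ?G ?F)"
    proof (rule nat_transI)
      show "?\<eta> M \<in> Hom ?A (FOb id_functor M) (FOb (comp_functor ?G ?F) M)" if "M \<in> Ob ?A" for M
        using closed[OF that] that by (simp add: GF id_functor_def) (simp add: functor_category_def)
      fix M M' \<tau>
      assume M: "M \<in> Ob ?A" "M' \<in> Ob ?A" "\<tau> \<in> Hom ?A M M'"
      interpret M: presheaf_in_universe C M using M by (intro Ob_A)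
      interpret M': presheaf_in_universe C M' using M by (intro Ob_A)
      interpret \<tau>: presheaf_map C M M' \<tau>
        using M by unfold_locales (simp add: functor_category_def)
      \<comment> \<open>At \<open>a\<close> and \<open>x\<close> both composites are the image of \<open>\<tau>\<^sub>a(x)\<close>, placed in the summand \<open>a\<close>.\<close>
      have "M'.unit a (\<tau> a x) = FMor ?G (FOb ?F M) (FOb ?F M') (FMor ?F M M' \<tau>) a (M.unit a x)"
        if a: "a \<in> Ob C" and x: "x \<in> carrier (FOb M a)" for a x
      proof -
        have "M.unit a x \<in> carrier (component C M.transported.T a)"
          using bij_betwE[OF M.unit_bij[OF a]] x by blast
        then show ?thesis
          using a x by (simp add: G_Mor F_Mor F_Ob M.unit_def M'.unit_def \<tau>.component_closed
              M.transported.transport_map_e M.sum_inj_closed_S \<tau>.sum_map_sum_inj)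
      qed
      then show "Comp ?A (FOb id_functor M) (FOb id_functor M') (FOb (comp_functor ?G ?F) M')
            (?\<eta> M') (FMor id_functor M M' \<tau>)
          = Comp ?A (FOb id_functor M) (FOb (comp_functor ?G ?F) M) (FOb (comp_functor ?G ?F) M')
            (FMor (comp_functor ?G ?F) M M' \<tau>) (?\<eta> M)"
        using M(1,2)
        by (auto simp: functor_category_def id_functor_def comp_functor_def opposite_def Ab_def
            compose_def intro!: restrict_ext)
    qed simp
    moreover have "isomorphism ?A M (?GF M) (presheaf_in_universe.unit C M)" if M: "M \<in> Ob ?A" for M
    proof -
      interpret M: presheaf_in_universe C M using M by (rule Ob_A)
      interpret T: unital_right_module C M.transported.T by (rule M.unital_right_module_T)
      show ?thesis
      proof (rule isomorphism_functor_category)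
        show "linear_functor (opposite C) Ab M" "linear_functor (opposite C) Ab (?GF M)"
          using M.presheaf_axioms T.presheaf_module_functor
          by (simp_all add: presheaf_iff_linear_functor[OF C])
        show "isomorphism Ab (FOb M a) (FOb (?GF M) a) (M.unit a)" if "a \<in> Ob (opposite C)" for a
        proof -
          have a: "a \<in> Ob C"
            using that by (simp add: opposite_def)
          show ?thesis
            using M.unit_bij[OF a] nat_trans_closed[OF M.unit_nat_trans that] a
            by (intro isomorphism_Ab) (auto intro: M.comm_group_FOb T.comm_group_component)
        qed
      qed (rule M.unit_nat_trans)
    qed
    ultimately show ?thesis
      unfolding naturally_isomorphic_def by (intro bexI[of _ ?\<eta>]) (simp_all add: GF, simp add: id_functor_def)
  qed
  moreover have "naturally_isomorphic ?B ?B (comp_functor ?F ?G) id_functor"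
  proof -
    let ?\<epsilon> = "\<lambda>N \<in> Ob ?B. module_in_universe.counit_map C N"
    let ?FG = "\<lambda>N. transport_module (direct_sum_module C (module_functor C N)) :: ('u, 'o \<times> 'o \<Rightarrow> 'm) right_module"
    have FG: "FOb (comp_functor ?F ?G) N = ?FG N" for N
      by (simp add: comp_functor_def G_Ob F_Ob)
    have FG_Mor: "FMor (comp_functor ?F ?G) N P \<phi> = FMor ?F (FOb ?G N) (FOb ?G P) (FMor ?G N P \<phi>)"
      for N P \<phi>
      by (simp add: comp_functor_def)
    have Comp_B: "Comp ?B N P Q \<psi> \<phi> = compose (carrier N) \<psi> \<phi>" for N P Q \<psi> \<phi>
      by (simp add: unital_modules_def)
    have closed: "module_in_universe.counit_map C N \<in> Hom ?B (?FG N) N" if "N \<in> Ob ?B" for N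
      by (rule module_in_universe.counit_map_hom[OF Ob_B[OF that]])
    have "?\<epsilon> \<in> nat_trans ?B ?B (comp_functor ?F ?G) id_functor"
    proof (rule nat_transI)
      show "?\<epsilon> N \<in> Hom ?B (FOb (comp_functor ?F ?G) N) (FOb id_functor N)" if "N \<in> Ob ?B" for N
        using closed[OF that] that by (simp add: FG id_functor_def)
      fix N P \<phi>
      assume N: "N \<in> Ob ?B" "P \<in> Ob ?B" "\<phi> \<in> Hom ?B N P"
      interpret N: module_in_universe C N using N by (intro Ob_B)
      interpret P: module_in_universe C P using N by (intro Ob_B)
      interpret \<phi>: module_map C N P \<phi> using N by unfold_locales
      interpret c: presheaf_map C "module_functor C N" "module_functor C P" \<phi>.components
        by unfold_locales (rule \<phi>.components_nat_trans)
      have "P.counit_map (FMor ?F (FOb ?G N) (FOb ?G P) (FMor ?G N P \<phi>) y) = \<phi> (N.counit_map y)"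
        if y: "y \<in> carrier (?FG N)" for y
      proof -
        obtain m where m: "m \<in> carrier N.presheaf.S" "y = N.dsum.embed m"
          using y by (auto simp: N.dsum.transported.carrier_T)
        have "FMor ?F (FOb ?G N) (FOb ?G P) (FMor ?G N P \<phi>) y
            = P.dsum.embed (sum_map C \<phi>.components m)"
          using m(1) N.dsum.transported.transport_map_e[OF m(1)]
          unfolding F_Mor G_Ob G_Mor m(2) \<phi>.components_def by simp
        then show ?thesis
          using m(1) c.sum_map_closed[OF m(1)] \<phi>.counit_natural[OF m(1)]
          by (simp add: m(2) N.counit_map_embed P.counit_map_embed)
      qed
      then show "Comp ?B (FOb (comp_functor ?F ?G) N) (FOb (comp_functor ?F ?G) P) (FOb id_functor P)
            (?\<epsilon> P) (FMor (comp_functor ?F ?G) N P \<phi>)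
          = Comp ?B (FOb (comp_functor ?F ?G) N) (FOb id_functor N) (FOb id_functor P)
            (FMor id_functor N P \<phi>) (?\<epsilon> N)"
        using N(1,2) by (auto simp: FG FG_Mor Comp_B compose_def id_functor_def intro!: restrict_ext)
    qed simp
    moreover have "isomorphism ?B (?FG N) N (module_in_universe.counit_map C N)" if N: "N \<in> Ob ?B" for N
    proof -
      interpret N: module_in_universe C N using N by (rule Ob_B)
      have "?FG N \<in> Ob ?B"
        using N.dsum.sum_functor_closed by (simp add: F_Ob)
      then show ?thesis
        using N N.counit_map_hom N.counit_map_bij by (rule isomorphism_unital_modules)
    qed
    ultimately show ?thesis
      unfolding naturally_isomorphic_def by (intro bexI[of _ ?\<epsilon>]) (simp_all add: FG, simp add: id_functor_def)
  qed
  ultimately show ?thesis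
    using F G unfolding mutually_quasi_inverse_def by blast
qed

end
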